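(* Let $P\in\mathbb C[x_1,x_2,x_3]$ be any polynomial from the following list (with the indicated parameters): (PV) $x_1x_2x_3+x_1^2+x_2^2-(s_1+s_2s_3)x_1-(s_2+s_1s_3)x_2-s_3x_3+(s_3^2+s_1s_2s_3+1)$, $s_1,s_2\in\mathbb C$, $s_3\in\mathbb C^*$; (PV$^{\deg}$) $x_1x_2x_3+x_1^2+x_2^2+s_1x_1+s_2x_2+1$, $s_1,s_2\in\mathbb C$; (PIII(D6)) $x_1x_2x_3+x_1^2+x_2^2+(1+\alpha\beta)x_1+(\alpha+\beta)x_2+\alpha\beta$, $\alpha,\beta\in\mathbb C^*$; (PIII(D7)) $x_1x_2x_3+x_1^2+x_2^2+\alpha x_1+x_2$, $\alpha\in\mathbb C^*$; (PIII(D8)) $x_1x_2x_3+x_1^2-x_2^2-x_1$; (PIV) $x_1x_2x_3+x_1^2-(s_2^2+s_1s_2)x_1-s_2^2x_2-s_2^2x_3+(s_2^2+s_1s_2^3)$, $s_1\in\mathbb C$, $s_2\in\mathbb C^*$; (PII$^{FN}$) $x_1x_2x_3+x_1-x_2+x_3+s$, $s\in\mathbb C$; (PII) $x_1x_2x_3-x_1-\alpha x_2-x_3+\alpha+1$, $\alpha\in\mathbb C^*$; (PI) $x_1x_2x_3+x_1+x_2+1$. Let $S=\{P=0\}\subset\mathbb C^3$, with symplectic form $\Omega=\frac{dx_1\wedge dx_2}{P_{x_3}}=\frac{dx_2\wedge dx_3}{P_{x_1}}=\frac{dx_3\wedge dx_1}{P_{x_2}}$ (where $P_{x_i}=\partial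 P/\partial x_i$), and foliations $\mathcal F_i=\ker(dx_i|_S)$, $i=1,2,3$. Then: (1) the $3$-web $(\mathcal F_1,\mathcal F_2,\mathcal F_3)$ is not (locally) parallelizable, except in the cases PII$^{FN}$, PII, PI; (2) for at least one pair $\{i,j\}\subset\{1,2,3\}$, the Hess connection of the bi-Lagrangian manifold $(S,\Omega,\mathcal F_i,\mathcal F_j)$ is not flat.
   Context: A regular $3$-web is a triple of pairwise transversal holomorphic foliations on a complex surface; it is locally parallelizable if in suitable local holomorphic coordinates each foliation is given by a constant $1$-form (parallel lines). Everything is considered on the open subset of smooth points of $S$ where the relevant foliations are pairwise transversal. The Hess connection of a bi-Lagrangian surface $(M,\omega,\mathcal F,\mathcal G)$ (transversal foliations by curves) is the unique torsion-free affine connection $\nabla$ with $X\cdot\omega(Y,Z)=\omega(\nabla_XY,Z)+\omega(Y,\nabla_XZ)$ and preserving both foliations (i.e. $\nabla_XY$ tangent to a foliation whenever $Y$ is); it is flat if its curvature tensor vanishes identically. *)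

theory Defs
  imports "HOL-Analysis.Analysis"
begin

type_synonym pt3 = "complex \<times> complex \<times> complex"
type_synonym pt2 = "complex \<times> complex"

definition coord :: "nat \<Rightarrow> pt3 \<Rightarrow> complex" where
  "coord i x = (if i = 1 then fst x else if i = 2 then fst (snd x) else snd (snd x))"

definition upd3 :: "nat \<Rightarrow> complex \<Rightarrow> pt3 \<Rightarrow> pt3" where
  "upd3 i t x = (if i = 1 then (t, fst (snd x), snd (snd x))
                 else if i = 2 then (fst x, t, snd (snd x))
                 else (fst x, fst (snd x), t))"

definition pdP :: "(pt3 \<Rightarrow> complex) \<Rightarrow> nat \<Rightarrow> pt3 \<Rightarrow> complex" where
  "pdP P i x = deriv (\<lambda>t. P (upd3 i t x)) (coord i x)"

definition surf :: "(pt3 \<Rightarrow> complex) \<Rightarrow> pt3 set" where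
  "surf P = {x. P x = 0}"

text \<open>Open subset of S where F_1, F_2, F_3 are pairwise transversal (F_i, F_j are
  transversal at a point of S exactly when P_{x_k} does not vanish there, {i,j,k}={1,2,3}).\<close>
definition web_region :: "(pt3 \<Rightarrow> complex) \<Rightarrow> pt3 set" where
  "web_region P = {x \<in> surf P. \<forall>k\<in>{1,2,3}. pdP P k x \<noteq> 0}"

text \<open>Open subset of S where F_i and F_j are transversal.\<close>
definition pair_region :: "(pt3 \<Rightarrow> complex) \<Rightarrow> nat \<Rightarrow> nat \<Rightarrow> pt3 set" where
  "pair_region P i j = {x \<in> surf P. \<forall>k\<in>{1,2,3}. k \<noteq> i \<longrightarrow> k \<noteq> j \<longrightarrow> pdP P k x \<noteq> 0}"

definition Omega :: "(pt3 \<Rightarrow> complex) \<Rightarrow> pt3 \<Rightarrow> pt3 \<Rightarrow> pt3 \<Rightarrow> complex" where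
  "Omega P x u v =
     (if pdP P 3 x \<noteq> 0 then (coord 1 u * coord 2 v - coord 2 u * coord 1 v) / pdP P 3 x
      else if pdP P 1 x \<noteq> 0 then (coord 2 u * coord 3 v - coord 3 u * coord 2 v) / pdP P 1 x
      else (coord 3 u * coord 1 v - coord 1 u * coord 3 v) / pdP P 2 x)"

definition holo2 :: "(pt2 \<Rightarrow> complex) \<Rightarrow> pt2 set \<Rightarrow> bool" where
  "holo2 f V \<longleftrightarrow> open V \<and>
     (\<forall>y\<in>V. \<exists>a b. (f has_derivative (\<lambda>v. a * fst v + b * snd v)) (at y))"

definition d2 :: "nat \<Rightarrow> (pt2 \<Rightarrow> complex) \<Rightarrow> pt2 \<Rightarrow> complex" where
  "d2 a f y = (if a = 1 then deriv (\<lambda>t. f (t, snd y)) (fst y)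
               else deriv (\<lambda>t. f (fst y, t)) (snd y))"

definition dvec :: "nat \<Rightarrow> (pt2 \<Rightarrow> pt3) \<Rightarrow> pt2 \<Rightarrow> pt3" where
  "dvec a phi y = (d2 a (\<lambda>z. coord 1 (phi z)) y, d2 a (\<lambda>z. coord 2 (phi z)) y,
                   d2 a (\<lambda>z. coord 3 (phi z)) y)"

text \<open>A local holomorphic coordinate system on the (open) subset U of S around p,
  given by its holomorphic parametrisation phi : V -> U (a holomorphic immersion which is a
  homeomorphism of V onto an open neighbourhood of p in U).\<close>
definition hol_chart :: "pt3 set \<Rightarrow> (pt2 \<Rightarrow> pt3) \<Rightarrow> pt2 set \<Rightarrow> pt3 \<Rightarrow> bool" where
  "hol_chart U phi V p \<longleftrightarrow>
     open V \<and> (\<forall>i\<in>{1,2,3}. holo2 (\<lambda>y. coord i (phi y)) V) \<and>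
     phi ` V \<subseteq> U \<and> p \<in> phi ` V \<and> openin (top_of_set U) (phi ` V) \<and>
     inj_on phi V \<and> continuous_on (phi ` V) (the_inv_into V phi) \<and>
     (\<forall>y\<in>V. \<forall>c1 c2. 
        (\<forall>i\<in>{1,2,3}. c1 * coord i (dvec 1 phi y) + c2 * coord i (dvec 2 phi y) = 0)
        \<longrightarrow> c1 = 0 \<and> c2 = 0)"

definition web_locally_parallelizable :: "(pt3 \<Rightarrow> complex) \<Rightarrow> bool" where
  "web_locally_parallelizable P \<longleftrightarrow>
     (\<forall>p\<in>web_region P. \<exists>phi V. hol_chart (web_region P) phi V p \<and>
        (\<forall>i\<in>{1,2,3}. \<exists>c1 c2. (c1, c2) \<noteq> (0, 0) \<and>
           (\<forall>y\<in>V. \<forall>v1 v2.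
              d2 1 (\<lambda>z. coord i (phi z)) y * v1 + d2 2 (\<lambda>z. coord i (phi z)) y * v2 = 0
              \<longleftrightarrow> c1 * v1 + c2 * v2 = 0)))"

text \<open>Affine connection in the chart: nabla_{e_a} e_b = sum_c Gam c a b e_c.\<close>

definition cov_deriv :: "(nat \<Rightarrow> nat \<Rightarrow> nat \<Rightarrow> pt2 \<Rightarrow> complex) \<Rightarrow> nat \<Rightarrow>
    (nat \<Rightarrow> pt2 \<Rightarrow> complex) \<Rightarrow> nat \<Rightarrow> pt2 \<Rightarrow> complex" where
  "cov_deriv Gam a Y c y = d2 a (Y c) y + (\<Sum>b\<in>{1,2}. Gam c a b y * Y b y)"

definition tangent_fol :: "(pt2 \<Rightarrow> pt3) \<Rightarrow> nat \<Rightarrow> pt2 \<Rightarrow> complex \<Rightarrow> complex \<Rightarrow> bool" where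
  "tangent_fol phi i y v1 v2 \<longleftrightarrow>
     d2 1 (\<lambda>z. coord i (phi z)) y * v1 + d2 2 (\<lambda>z. coord i (phi z)) y * v2 = 0"

definition is_hess_conn :: "(pt3 \<Rightarrow> complex) \<Rightarrow> nat \<Rightarrow> nat \<Rightarrow> (pt2 \<Rightarrow> pt3) \<Rightarrow> pt2 set \<Rightarrow>
    (nat \<Rightarrow> nat \<Rightarrow> nat \<Rightarrow> pt2 \<Rightarrow> complex) \<Rightarrow> bool" where
  "is_hess_conn P i j phi V Gam \<longleftrightarrow>
     (\<forall>a\<in>{1,2}. \<forall>b\<in>{1,2}. \<forall>c\<in>{1,2}. holo2 (Gam c a b) V) \<and>
     \<comment> \<open>torsion free\<close>
     (\<forall>a\<in>{1,2}. \<forall>b\<in>{1,2}. \<forall>c\<in>{1,2}. \<forall>y\<in>V. Gam c a b y = Gam c b a y) \<and>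
     \<comment> \<open>X.omega(Y,Z) = omega(nabla_X Y, Z) + omega(Y, nabla_X Z), on coordinate fields\<close>
     (\<forall>a\<in>{1,2}. \<forall>b\<in>{1,2}. \<forall>c\<in>{1,2}. \<forall>y\<in>V.
        d2 a (\<lambda>z. Omega P (phi z) (dvec b phi z) (dvec c phi z)) y =
          (\<Sum>e\<in>{1,2}. Gam e a b y * Omega P (phi y) (dvec e phi y) (dvec c phi y)) +
          (\<Sum>e\<in>{1,2}. Gam e a c y * Omega P (phi y) (dvec b phi y) (dvec e phi y))) \<and>
     \<comment> \<open>preserves F_i and F_j\<close>
     (\<forall>k\<in>{i,j}. \<forall>Y. holo2 (Y 1) V \<and> holo2 (Y 2) V \<and>
        (\<forall>y\<in>V. tangent_fol phi k y (Y 1 y) (Y 2 y)) \<longrightarrow>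
        (\<forall>a\<in>{1,2}. \<forall>y\<in>V. tangent_fol phi k y (cov_deriv Gam a Y 1 y) (cov_deriv Gam a Y 2 y)))"

text \<open>Curvature: component d of R(e_a,e_b)e_c = nabla_a nabla_b e_c - nabla_b nabla_a e_c.\<close>
definition curv :: "(nat \<Rightarrow> nat \<Rightarrow> nat \<Rightarrow> pt2 \<Rightarrow> complex) \<Rightarrow> nat \<Rightarrow> nat \<Rightarrow> nat \<Rightarrow> nat \<Rightarrow> pt2 \<Rightarrow> complex" where
  "curv Gam d c a b y =
     d2 a (Gam d b c) y - d2 b (Gam d a c) y +
     (\<Sum>e\<in>{1,2}. Gam e b c y * Gam d a e y - Gam e a c y * Gam d b e y)"

definition hess_flat :: "(pt3 \<Rightarrow> complex) \<Rightarrow> nat \<Rightarrow> nat \<Rightarrow> bool" where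
  "hess_flat P i j \<longleftrightarrow>
     (\<forall>p\<in>pair_region P i j. \<exists>phi V Gam. hol_chart (pair_region P i j) phi V p \<and>
        is_hess_conn P i j phi V Gam \<and>
        (\<forall>y\<in>V. \<forall>a\<in>{1,2}. \<forall>b\<in>{1,2}. \<forall>c\<in>{1,2}. \<forall>d\<in>{1,2}. curv Gam d c a b y = 0))"

definition nonexc_cubics :: "(pt3 \<Rightarrow> complex) set" where
  "nonexc_cubics =
    {P. \<exists>s1 s2 s3. s3 \<noteq> 0 \<and> P = (\<lambda>(x1,x2,x3). x1 * x2 * x3 + x1^2 + x2^2 - (s1 + s2 * s3)*x1
          - (s2 + s1 * s3)*x2 - s3 * x3 + (s3^2 + s1 * s2 * s3 + 1))} \<union>
    {P. \<exists>s1 s2. P = (\<lambda>(x1,x2,x3). x1 * x2 * x3 + x1^2 + x2^2 + s1 * x1 + s2 * x2 + 1)} \<union>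
    {P. \<exists>\<alpha> \<beta>. \<alpha> \<noteq> 0 \<and> \<beta> \<noteq> 0 \<and> P = (\<lambda>(x1,x2,x3). x1 * x2 * x3 + x1^2 + x2^2 + (1 + \<alpha>*\<beta>)*x1
          + (\<alpha> + \<beta>)*x2 + \<alpha>*\<beta>)} \<union>
    {P. \<exists>\<alpha>. \<alpha> \<noteq> 0 \<and> P = (\<lambda>(x1,x2,x3). x1 * x2 * x3 + x1^2 + x2^2 + \<alpha>*x1 + x2)} \<union>
    {(\<lambda>(x1,x2,x3). x1 * x2 * x3 + x1^2 - x2^2 - x1)} \<union>
    {P. \<exists>s1 s2. s2 \<noteq> 0 \<and> P = (\<lambda>(x1,x2,x3). x1 * x2 * x3 + x1^2 - (s2^2 + s1 * s2)*x1 - s2^2 * x2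
          - s2^2 * x3 + (s2^2 + s1 * s2^3))}"

definition exc_cubics :: "(pt3 \<Rightarrow> complex) set" where
  "exc_cubics =
    {P. \<exists>s. P = (\<lambda>(x1,x2,x3). x1 * x2 * x3 + x1 - x2 + x3 + s)} \<union>
    {P. \<exists>\<alpha>. \<alpha> \<noteq> 0 \<and> P = (\<lambda>(x1,x2,x3). x1 * x2 * x3 - x1 - \<alpha>*x2 - x3 + \<alpha> + 1)} \<union>
    {(\<lambda>(x1,x2,x3). x1 * x2 * x3 + x1 + x2 + 1)}"

end

theory Submission
  imports Defs "HOL-Complex_Analysis.Conformal_Mappings"
begin

text \<open>
  Let f and g be the restrictions of two coordinate functions. A torsion-free connection preserving
  the foliations they define satisfies \<open>\<nabla> df = s df \<otimes> df\<close> and \<open>\<nabla> dg = t dg \<otimes> dg\<close>, and if it is flat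
  then s is a function of f alone. For the Hess connection the area form \<open>df \<and> dg / L\<close> is parallel,
  whence \<open>s df + t dg = d log L\<close>, and flatness forces the mixed derivative of log L with respect to
  f and g to vanish. For a parallelizable web the flat connection of the linearizing chart
  gives \<open>t dg - s df = d log (N / M)\<close> when the third foliation is the kernel of \<open>N df + M dg\<close>, and the
  mixed derivative of log (N / M) vanishes. In both cases this is a polynomial identity on the
  surface, refuted by a leading coefficient.
\<close>

section \<open>Holomorphic functions of two variables\<close>

text \<open>Curvature contains second derivatives in an arbitrary chart, while \<open>holo2\<close>
  asserts only complex differentiability at each point. Holomorphy of the partial derivatives and
  symmetry of the mixed ones must therefore come before any computation with connections.

  All families share the shape \<open>x*y*z - c*z + e1*x^2 + e2*y^2 + a*x + b*y + d\<close>. For the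
  pair (1,2) the density is \<open>L = x*y - c\<close>, and the mixed derivative of log L is
  \<open>- c / L^2\<close>: it detects exactly \<open>c \<noteq> 0\<close>. For \<open>c = 0\<close>
  the pair (1,3) takes over; its density is P_{x_2}, of which in general only the square, a
  discriminant, is a function of x and z.

  For the web, N and M are P_{x_3} P_{x_1} and P_{x_3} P_{x_2} reduced modulo P to polynomials in x
  and y. If both squares are absent, N depends on y alone and M on x alone, so the mixed derivative
  of log (N / M) vanishes. This singles out PII^FN, PII and PI.\<close>

definition has_d2 :: "(pt2 \<Rightarrow> complex) \<Rightarrow> complex \<Rightarrow> complex \<Rightarrow> pt2 \<Rightarrow> bool" where
  "has_d2 f a b y \<longleftrightarrow> (f has_derivative (\<lambda>v. a * fst v + b * snd v)) (at y)"

lemma has_d2_partials: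
  assumes "has_d2 f a b y"
  shows "((\<lambda>t. f (t, snd y)) has_field_derivative a) (at (fst y))"
    and "((\<lambda>t. f (fst y, t)) has_field_derivative b) (at (snd y))"
proof -
  have f: "(f has_derivative (\<lambda>v. a * fst v + b * snd v)) (at (fst y, snd y))"
    using assms by (simp add: has_d2_def)
  have "((\<lambda>t. (t, snd y)) has_derivative (\<lambda>h. (h, 0))) (at (fst y))"
    by (auto intro!: derivative_eq_intros)
  from has_derivative_compose[OF this f]
  show "((\<lambda>t. f (t, snd y)) has_field_derivative a) (at (fst y))"
    by (simp add: has_field_derivative_def)
  have "((\<lambda>t. (fst y, t)) has_derivative (\<lambda>h. (0, h))) (at (snd y))"
    by (auto intro!: derivative_eq_intros)
  from has_derivative_compose[OF this f]
  show "((\<lambda>t. f (fst y, t)) has_field_derivative b) (at (snd y))"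
    by (simp add: has_field_derivative_def)
qed

lemma has_d2_eqs:
  assumes "has_d2 f a b y"
  shows "d2 (Suc 0) f y = a" "d2 2 f y = b"
  using has_d2_partials[OF assms] by (auto simp: d2_def DERIV_imp_deriv)

lemma holo2_iff: "holo2 f V \<longleftrightarrow> open V \<and> (\<forall>y\<in>V. has_d2 f (d2 1 f y) (d2 2 f y) y)"
proof
  assume h: "holo2 f V"
  have "has_d2 f (d2 1 f y) (d2 2 f y) y" if "y \<in> V" for y
  proof -
    obtain a b where "has_d2 f a b y"
      using h \<open>y \<in> V\<close> unfolding holo2_def has_d2_def by blast
    then show ?thesis using has_d2_eqs[of f a b y] by simp
  qed
  then show "open V \<and> (\<forall>y\<in>V. has_d2 f (d2 1 f y) (d2 2 f y) y)"
    using h by (auto simp: holo2_def)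
qed (auto simp: holo2_def has_d2_def)

lemma holo2_has_d2: "holo2 f V \<Longrightarrow> y \<in> V \<Longrightarrow> has_d2 f (d2 (Suc 0) f y) (d2 2 f y) y"
  by (simp add: holo2_iff)

lemma holo2_open: "holo2 f V \<Longrightarrow> open V"
  by (simp add: holo2_def)

lemma holo2I: "open V \<Longrightarrow> (\<And>y. y \<in> V \<Longrightarrow> \<exists>a b. has_d2 f a b y) \<Longrightarrow> holo2 f V"
  by (simp add: holo2_def has_d2_def)

lemma has_d2_const: "has_d2 (\<lambda>y. k) 0 0 y"
  by (simp add: has_d2_def)

lemma has_d2_fst: "has_d2 fst 1 0 y"
  by (simp add: has_d2_def has_derivative_fst)

lemma has_d2_snd: "has_d2 snd 0 1 y"
  by (simp add: has_d2_def has_derivative_snd)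

lemma has_d2_add: "has_d2 f a b y \<Longrightarrow> has_d2 g c d y \<Longrightarrow> has_d2 (\<lambda>y. f y + g y) (a + c) (b + d) y"
  unfolding has_d2_def
  by (drule (1) has_derivative_add) (simp add: algebra_simps)

lemma has_d2_diff: "has_d2 f a b y \<Longrightarrow> has_d2 g c d y \<Longrightarrow> has_d2 (\<lambda>y. f y - g y) (a - c) (b - d) y"
  unfolding has_d2_def
  by (drule (1) has_derivative_diff) (simp add: algebra_simps)

lemma has_d2_mult:
  "has_d2 f a b y \<Longrightarrow> has_d2 g c d y \<Longrightarrow>
    has_d2 (\<lambda>y. f y * g y) (a * g y + f y * c) (b * g y + f y * d) y"
  unfolding has_d2_def
  by (drule (1) has_derivative_mult) (simp add: algebra_simps)

lemma has_d2_DERIV: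
  assumes "(h has_field_derivative k) (at (f y))" "has_d2 f a b y"
  shows "has_d2 (\<lambda>y. h (f y)) (k * a) (k * b) y"
  using has_derivative_compose[OF assms(2)[unfolded has_d2_def]
      assms(1)[unfolded has_field_derivative_def]]
  by (simp add: has_d2_def algebra_simps)

lemma has_d2_divide:
  assumes "has_d2 f a b y" "has_d2 g c d y" "g y \<noteq> 0"
  shows "has_d2 (\<lambda>y. f y / g y) ((a * g y - f y * c) / (g y)\<^sup>2) ((b * g y - f y * d) / (g y)\<^sup>2) y"
proof -
  have "(inverse has_field_derivative - (inverse (g y) ^ 2)) (at (g y))"
    using DERIV_inverse[OF assms(3)] by (simp add: numeral_2_eq_2)
  from has_d2_mult[OF assms(1) has_d2_DERIV[OF this assms(2)]] assms(3)
  show ?thesis by (simp add: divide_simps power2_eq_square algebra_simps)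
qed

lemma has_d2_pair:
  assumes "has_d2 F A B (f y, g y)" "has_d2 f a b y" "has_d2 g c d y"
  shows "has_d2 (\<lambda>y. F (f y, g y)) (A * a + B * c) (A * b + B * d) y"
  using has_derivative_compose[OF has_derivative_Pair[OF assms(2,3)[unfolded has_d2_def]]
      assms(1)[unfolded has_d2_def]]
  by (simp add: has_d2_def algebra_simps)

lemma has_d2_cong:
  assumes "has_d2 f a b y" "open V" "y \<in> V" "\<And>z. z \<in> V \<Longrightarrow> f z = g z"
  shows "has_d2 g a b y"
  using has_derivative_transform_within_open[OF assms(1)[unfolded has_d2_def] assms(2,3)] assms(4)
  by (simp add: has_d2_def)

lemma has_d2_eq: "has_d2 f a b y \<Longrightarrow> a = a' \<Longrightarrow> b = b' \<Longrightarrow> has_d2 f a' b' y"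
  by simp

lemmas has_d2_intros = has_d2_const has_d2_fst has_d2_snd has_d2_add has_d2_diff has_d2_mult

section \<open>Separately holomorphic functions: regularity and symmetry of partial
  derivatives\<close>

definition sephol :: "(pt2 \<Rightarrow> complex) \<Rightarrow> pt2 set \<Rightarrow> bool" where
  "sephol f V \<longleftrightarrow> open V \<and> continuous_on V f \<and>
     (\<forall>z w. (z, w) \<in> V \<longrightarrow>
        (\<lambda>t. f (t, w)) field_differentiable at z \<and> (\<lambda>t. f (z, t)) field_differentiable at w)"

text \<open>Continuity together with holomorphy of every slice is the property that one-variable
  theorems reproduce for the partial derivatives; \<open>sephol_imp_holo2\<close> is the way
  back.\<close>

lemma holo2_imp_sephol:
  assumes "holo2 f V"
  shows "sephol f V"
  unfolding sephol_def
proof (intro conjI allI impI)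
  show "open V" using assms by (rule holo2_open)
  show "continuous_on V f"
    using assms has_derivative_continuous unfolding holo2_def
    by (intro continuous_at_imp_continuous_on) blast
  fix z w assume "(z, w) \<in> V"
  from has_d2_partials[OF holo2_has_d2[OF assms this]]
  show "(\<lambda>t. f (t, w)) field_differentiable at z" "(\<lambda>t. f (z, t)) field_differentiable at w"
    by (auto simp: field_differentiable_def)
qed

lemma sephol_swap:
  assumes "sephol f V"
  shows "sephol (\<lambda>y. f (snd y, fst y)) {y. (snd y, fst y) \<in> V}"
proof -
  have "open {y. (snd y, fst y) \<in> V}"
    using assms continuous_on_open_vimage[of UNIV "\<lambda>y::pt2. (snd y, fst y)"]
    by (auto simp: sephol_def vimage_def intro!: continuous_intros)
  moreover have "continuous_on {y. (snd y, fst y) \<in> V} (\<lambda>y. f (snd y, fst y))"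
    by (rule continuous_on_compose2[of V f]) (use assms in \<open>auto simp: sephol_def intro!: continuous_intros\<close>)
  ultimately show ?thesis using assms by (auto simp: sephol_def)
qed

lemma open_contains_bidisc:
  assumes "open V" "(z, w) \<in> V"
  obtains r where "r > 0" "cball z r \<times> cball w r \<subseteq> (V :: pt2 set)"
proof -
  obtain A B where AB: "open A" "open B" "(z, w) \<in> A \<times> B" "A \<times> B \<subseteq> V"
    using open_prod_elim[OF assms] by blast
  obtain r where r: "r > 0" "cball z r \<subseteq> A"
    using AB(1,3) open_contains_cball by blast
  obtain s where s: "s > 0" "cball w s \<subseteq> B"
    using AB(2,3) open_contains_cball by blast
  have "cball z (min r s) \<times> cball w (min r s) \<subseteq> A \<times> B"
    using r s by (intro Sigma_mono) (auto simp: subset_iff)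
  then have "cball z (min r s) \<times> cball w (min r s) \<subseteq> V"
    using AB(4) by blast
  then show thesis using that[of "min r s"] \<open>r > 0\<close> \<open>s > 0\<close> by simp
qed

text \<open>Cauchy's estimate for the slices turns uniform continuity of f into continuity of its
  partial derivative.\<close>

lemma sephol_d2_continuous_1:
  assumes "sephol f V"
  shows "continuous_on V (d2 1 f)"
proof -
  have "open V" "continuous_on V f"
    and hz: "\<And>z w. (z, w) \<in> V \<Longrightarrow> (\<lambda>t. f (t, w)) field_differentiable at z"
    using assms by (auto simp: sephol_def)
  have "continuous (at (z0, w0)) (d2 1 f)" if p: "(z0, w0) \<in> V" for z0 w0
    unfolding continuous_at_eps_delta
  proof (intro allI impI)
    fix e :: real assume "e > 0"
    obtain R where R: "R > 0" "cball z0 R \<times> cball w0 R \<subseteq> V"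
      using open_contains_bidisc[OF \<open>open V\<close> p] by blast
    \<comment> \<open>Half of the radius: for z within r of z0, the disc of radius r around z, where
      Cauchy's estimate is applied, stays inside the bidisc.\<close>
    define r where "r = R / 2"
    have r: "r > 0" "R = 2 * r" using R by (auto simp: r_def)
    define K where "K = cball z0 R \<times> cball w0 R"
    have "compact K" by (simp add: K_def compact_Times)
    moreover have "continuous_on K f"
      using continuous_on_subset[OF \<open>continuous_on V f\<close>] R by (simp add: K_def)
    ultimately have uc: "uniformly_continuous_on K f" by (rule compact_uniformly_continuous[rotated])
    have "e * r / 2 > 0" using \<open>e > 0\<close> r by simp
    from uniformly_continuous_onE[OF uc this] obtain d1 where d1: "d1 > 0"
      "\<And>x y. x \<in> K \<Longrightarrow> y \<in> K \<Longrightarrow> dist y x < d1 \<Longrightarrow> dist (f y) (f x) < e * r / 2"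
      by blast
    have hol: "(\<lambda>t. f (t, w)) holomorphic_on cball z0 R" if "w \<in> cball w0 R" for w
      unfolding holomorphic_on_def
    proof
      fix t assume "t \<in> cball z0 R"
      then have "(t, w) \<in> V" using subsetD[OF R(2), of "(t, w)"] that by simp
      then show "(\<lambda>t. f (t, w)) field_differentiable at t within cball z0 R"
        by (rule field_differentiable_at_within[OF hz])
    qed
    have "isCont (deriv (\<lambda>t. f (t, w0))) z0"
    proof -
      have "(\<lambda>t. f (t, w0)) holomorphic_on ball z0 R"
        using hol[of w0] R by (auto intro: holomorphic_on_subset)
      then have "deriv (\<lambda>t. f (t, w0)) holomorphic_on ball z0 R"
        by (rule holomorphic_deriv) simp
      then have "continuous_on (ball z0 R) (deriv (\<lambda>t. f (t, w0)))"
        by (rule holomorphic_on_imp_continuous_on)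
      then show ?thesis using R by (simp add: continuous_on_eq_continuous_at)
    qed
    then obtain d2' where d2': "d2' > 0" "\<And>z. dist z z0 < d2' \<Longrightarrow>
        dist (deriv (\<lambda>t. f (t, w0)) z) (deriv (\<lambda>t. f (t, w0)) z0) < e / 2"
      unfolding continuous_at_eps_delta using \<open>e > 0\<close> by (metis half_gt_zero)
    show "\<exists>d>0. \<forall>x'. dist x' (z0, w0) < d \<longrightarrow> dist (d2 1 f x') (d2 1 f (z0, w0)) < e"
    proof (intro exI conjI allI impI)
      show "min r (min d1 d2') > 0" using r d1 d2' by simp
      fix p' assume d: "dist p' (z0, w0) < min r (min d1 d2')"
      obtain z w where p': "p' = (z, w)" by (cases p')
      have dz: "dist z z0 < min r (min d1 d2')" and dw: "dist w w0 < min r (min d1 d2')"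
        using d dist_fst_le[of p' "(z0, w0)"] dist_snd_le[of p' "(z0, w0)"] by (auto simp: p')
      have sub: "cball z r \<subseteq> cball z0 R"
      proof
        fix t assume "t \<in> cball z r"
        then show "t \<in> cball z0 R"
          using dz dist_triangle[of z0 t z] by (auto simp: r(2) dist_commute)
      qed
      have wK: "w \<in> cball w0 R" "w0 \<in> cball w0 R" using dw r by (auto simp: dist_commute)
      \<comment> \<open>The change of the derivative from (z0, w0) to (z, w) is split in two:
        between the slices w and w0 it is the derivative of \<open>?D\<close>, bounded by Cauchy's
        estimate; within the slice w0 it is controlled by one-variable continuity. Each costs e /
        2.\<close>
      let ?D = "\<lambda>t. f (t, w) - f (t, w0)"
      have holD: "?D holomorphic_on cball z r"
        using hol[OF wK(1)] hol[OF wK(2)] sub by (intro holomorphic_intros) (auto intro: holomorphic_on_subset)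
      have "norm ((deriv ^^ 1) ?D z) \<le> fact 1 * (e * r / 2) / r ^ 1"
      proof (rule Cauchy_inequality)
        show "?D holomorphic_on ball z r" using holD by (rule holomorphic_on_subset) auto
        show "continuous_on (cball z r) ?D" using holD by (rule holomorphic_on_imp_continuous_on)
        show "r > 0" by fact
        fix t assume "norm (z - t) = r"
        then have "t \<in> cball z0 R" using sub by (auto simp: dist_norm)
        then have "dist (f (t, w)) (f (t, w0)) < e * r / 2"
          using wK dw by (intro d1(2)) (auto simp: K_def dist_Pair_Pair)
        then show "norm (?D t) \<le> e * r / 2" by (simp add: dist_norm)
      qed
      then have "norm (deriv ?D z) \<le> e / 2" using r by simp
      moreover have "z \<in> cball z0 R" using dz r by (auto simp: dist_commute)
      then have "(z, w) \<in> V" "(z, w0) \<in> V" using R wK by auto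
      then have "deriv ?D z = d2 1 f (z, w) - d2 1 f (z, w0)"
        using hz by (simp add: d2_def deriv_diff)
      moreover have "dist (d2 1 f (z, w0)) (d2 1 f (z0, w0)) < e / 2"
        using d2'(2)[of z] dz by (simp add: d2_def)
      ultimately show "dist (d2 1 f p') (d2 1 f (z0, w0)) < e"
        using dist_triangle[of "d2 1 f (z, w)" "d2 1 f (z0, w0)" "d2 1 f (z, w0)"]
        by (simp add: p' dist_norm)
    qed
  qed
  then show ?thesis using \<open>open V\<close> by (auto intro!: continuous_at_imp_continuous_on)
qed

lemma d2_swap: "d2 (Suc 0) (\<lambda>y. f (snd y, fst y)) (w, z) = d2 2 f (z, w)"
  by (simp add: d2_def)

lemma sephol_d2_continuous_2:
  assumes "sephol f V"
  shows "continuous_on V (d2 2 f)"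
proof -
  have "continuous_on {y. (snd y, fst y) \<in> V} (d2 1 (\<lambda>y. f (snd y, fst y)))"
    by (rule sephol_d2_continuous_1[OF sephol_swap[OF assms]])
  then have "continuous_on V (\<lambda>y. d2 1 (\<lambda>y. f (snd y, fst y)) (snd y, fst y))"
    by (rule continuous_on_compose2) (auto intro!: continuous_intros)
  then show ?thesis by (simp add: d2_swap cong: continuous_on_cong)
qed

text \<open>The difference quotients of f in the first variable converge locally uniformly in the second
  one, so Weierstrass gives both the holomorphy of the limit and the symmetry of mixed partials.\<close>

lemma sephol_mixed:
  assumes sh: "sephol f V" and p: "(z0, w0) \<in> V"
  obtains c where "((\<lambda>w. d2 1 f (z0, w)) has_field_derivative c) (at w0)"
    "(\<lambda>n. (d2 2 f (z0 + inverse (of_nat (Suc n)), w0) - d2 2 f (z0, w0)) / inverse (of_nat (Suc n)))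
       \<longlonglongrightarrow> c"
proof -
  have "open V" and cf: "continuous_on V f"
    and hz: "\<And>z w. (z, w) \<in> V \<Longrightarrow> ((\<lambda>t. f (t, w)) has_field_derivative d2 1 f (z, w)) (at z)"
    and hw: "\<And>z w. (z, w) \<in> V \<Longrightarrow> ((\<lambda>t. f (z, t)) has_field_derivative d2 2 f (z, w)) (at w)"
    using sh by (auto simp: sephol_def d2_def DERIV_deriv_iff_field_differentiable)
  obtain R where R: "R > 0" "cball z0 R \<times> cball w0 R \<subseteq> V"
    using open_contains_bidisc[OF \<open>open V\<close> p] by blast
  define K where "K = cball z0 R \<times> cball w0 R"
  have KV: "(z, w) \<in> V" if "z \<in> cball z0 R" "w \<in> cball w0 R" for z w
    using R that by blast
  have "compact K" by (simp add: K_def compact_Times)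
  moreover have "continuous_on K (d2 1 f)"
    using continuous_on_subset[OF sephol_d2_continuous_1[OF sh]] R by (simp add: K_def)
  ultimately have uc: "uniformly_continuous_on K (d2 1 f)"
    by (rule compact_uniformly_continuous[rotated])
  define h :: "nat \<Rightarrow> complex" where "h n = inverse (of_nat (Suc n))" for n
  have h0: "h \<longlonglongrightarrow> 0"
    unfolding h_def using LIMSEQ_inverse_real_of_nat
    by (subst tendsto_norm_zero_iff[symmetric]) (simp add: norm_inverse del: of_nat_Suc)
  have hn: "h n \<noteq> 0" for n by (simp add: h_def del: of_nat_Suc)
  have ev: "\<forall>\<^sub>F n in sequentially. norm (h n) < e" if "e > 0" for e
    using tendstoD[OF h0 that] by (simp add: dist_norm)
  define F where "F n w = (f (z0 + h n, w) - f (z0, w)) / h n" for n w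
  define F' where "F' n w = (d2 2 f (z0 + h n, w) - d2 2 f (z0, w)) / h n" for n w
  have ul: "uniform_limit (cball w0 R) F (\<lambda>w. d2 1 f (z0, w)) sequentially"
  proof (rule uniform_limitI)
    fix e :: real assume "e > 0"
    then have "e / 2 > 0" by simp
    from uniformly_continuous_onE[OF uc this] obtain d where d: "d > 0"
      "\<And>x y. x \<in> K \<Longrightarrow> y \<in> K \<Longrightarrow> dist y x < d \<Longrightarrow> dist (d2 1 f y) (d2 1 f x) < e / 2"
      by blast
    have "min d R > 0" using d R by simp
    from ev[OF this]
    show "\<forall>\<^sub>F n in sequentially. \<forall>w\<in>cball w0 R. dist (F n w) (d2 1 f (z0, w)) < e"
    proof eventually_elim
      fix n assume n: "norm (h n) < min d R"
      show "\<forall>w\<in>cball w0 R. dist (F n w) (d2 1 f (z0, w)) < e"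
      proof
        fix w assume w: "w \<in> cball w0 R"
        \<comment> \<open>Subtracting the linear term turns the error of the difference quotient
          into an increment of \<open>?G\<close>, whose derivative is a difference of two values of
          \<open>d2 1 f\<close>, hence at most e / 2 by uniform continuity.\<close>
        let ?G = "\<lambda>t. f (t, w) - t * d2 1 f (z0, w)"
        have "norm (?G (z0 + h n) - ?G z0) \<le> e / 2 * norm (z0 + h n - z0)"
        proof (rule field_differentiable_bound[where S = "cball z0 (norm (h n))"
              and f' = "\<lambda>t. d2 1 f (t, w) - d2 1 f (z0, w)"])
          fix t assume t: "t \<in> cball z0 (norm (h n))"
          then have t': "t \<in> cball z0 R" using n by auto
          have "(?G has_field_derivative d2 1 f (t, w) - d2 1 f (z0, w)) (at t)"
            using hz[OF KV[OF t' w]] by (auto intro!: derivative_eq_intros)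
          then show "(?G has_field_derivative d2 1 f (t, w) - d2 1 f (z0, w))
              (at t within cball z0 (norm (h n)))"
            by (rule has_field_derivative_at_within)
          have "dist (t, w) (z0, w) < d" using t n by (simp add: dist_Pair_Pair dist_commute)
          then have "dist (d2 1 f (t, w)) (d2 1 f (z0, w)) < e / 2"
            using t' w R by (intro d) (auto simp: K_def)
          then show "norm (d2 1 f (t, w) - d2 1 f (z0, w)) \<le> e / 2" by (simp add: dist_norm)
        qed (auto simp: dist_norm)
        moreover have "?G (z0 + h n) - ?G z0 = h n * (F n w - d2 1 f (z0, w))"
          using hn[of n] by (simp add: F_def field_simps)
        ultimately have "norm (F n w - d2 1 f (z0, w)) \<le> e / 2"
          using hn[of n] by (simp add: norm_mult mult.commute[of "norm (h n)"])
        then show "dist (F n w) (d2 1 f (z0, w)) < e" using \<open>e > 0\<close> by (simp add: dist_norm)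
      qed
    qed
  qed
  have evF: "\<forall>\<^sub>F n in sequentially. continuous_on (cball w0 R) (F n) \<and>
      (\<forall>w\<in>ball w0 R. (F n has_field_derivative F' n w) (at w))"
    using ev[OF R(1)]
  proof eventually_elim
    fix n assume n: "norm (h n) < R"
    have "(F n has_field_derivative F' n w) (at w)" if w: "w \<in> cball w0 R" for w
    proof -
      have "(z0 + h n, w) \<in> V" "(z0, w) \<in> V"
        using n w R by (auto intro!: KV simp: dist_norm)
      from hw[OF this(1)] hw[OF this(2)] show ?thesis
        unfolding F_def F'_def using hn[of n] by (auto intro!: derivative_eq_intros)
    qed
    then show "continuous_on (cball w0 R) (F n) \<and>
      (\<forall>w\<in>ball w0 R. (F n has_field_derivative F' n w) (at w))"
      by (auto intro!: continuous_at_imp_continuous_on DERIV_isCont)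
  qed
  obtain g' where g': "\<And>w. w \<in> ball w0 R \<Longrightarrow>
      ((\<lambda>w. d2 1 f (z0, w)) has_field_derivative g' w) (at w) \<and> (\<lambda>n. F' n w) \<longlonglongrightarrow> g' w"
    by (rule has_complex_derivative_uniform_limit[OF evF ul]) (use R in auto)
  show thesis
    by (rule that[of "g' w0"]) (use g'[of w0] R in \<open>auto simp: F'_def h_def\<close>)
qed

text \<open>The derivative of a holomorphic slice is holomorphic, which settles the first variable;
  in the second variable the derivative exists by the Weierstrass limit in
  \<open>sephol_mixed\<close>.\<close>

lemma sephol_d2_1:
  assumes sh: "sephol f V"
  shows "sephol (d2 1 f) V"
proof -
  have "open V" using sh by (simp add: sephol_def)
  have "(\<lambda>t. d2 1 f (t, w)) field_differentiable at z" if p: "(z, w) \<in> V" for z w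
  proof -
    obtain R where R: "R > 0" "cball z R \<times> cball w R \<subseteq> V"
      using open_contains_bidisc[OF \<open>open V\<close> p] by blast
    have "(t, w) \<in> V" if "t \<in> ball z R" for t
      using subsetD[OF R(2), of "(t, w)"] R(1) that by simp
    then have "(\<lambda>t. f (t, w)) field_differentiable at t" if "t \<in> ball z R" for t
      using sh that unfolding sephol_def by blast
    then have "(\<lambda>t. f (t, w)) holomorphic_on ball z R"
      by (simp add: holomorphic_on_def field_differentiable_at_within)
    then have "deriv (\<lambda>t. f (t, w)) holomorphic_on ball z R"
      by (rule holomorphic_deriv) simp
    then show ?thesis
      using R by (simp add: d2_def holomorphic_on_imp_differentiable_at[of _ "ball z R"])
  qed
  moreover have "(\<lambda>t. d2 1 f (z, t)) field_differentiable at w" if p: "(z, w) \<in> V" for z w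
    using sephol_mixed[OF sh p] unfolding field_differentiable_def by metis
  ultimately show ?thesis
    using sephol_d2_continuous_1[OF sh] \<open>open V\<close> unfolding sephol_def by blast
qed

lemma sephol_d2_2:
  assumes "sephol f V"
  shows "sephol (d2 2 f) V"
proof -
  have *: "d2 2 f = (\<lambda>y. d2 1 (\<lambda>y. f (snd y, fst y)) (snd y, fst y))"
    by (auto simp: d2_def)
  from sephol_swap[OF sephol_d2_1[OF sephol_swap[OF assms]]] show ?thesis
    by (subst *) simp
qed

text \<open>One partial derivative exists and the other is continuous; this is enough for total
  differentiability.\<close>

lemma sephol_imp_holo2:
  assumes sh: "sephol f V"
  shows "holo2 f V"
proof (rule holo2I)
  show "open V" using sh by (simp add: sephol_def)
  fix y assume y: "y \<in> V"
  obtain z w where zw: "y = (z, w)" by (cases y)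
  have hz: "\<And>z w. (z, w) \<in> V \<Longrightarrow> ((\<lambda>t. f (t, w)) has_field_derivative d2 1 f (z, w)) (at z)"
    and hw: "\<And>z w. (z, w) \<in> V \<Longrightarrow> ((\<lambda>t. f (z, t)) has_field_derivative d2 2 f (z, w)) (at w)"
    using sh by (auto simp: sephol_def d2_def DERIV_deriv_iff_field_differentiable)
  obtain R where R: "R > 0" "cball z R \<times> cball w R \<subseteq> V"
    using open_contains_bidisc[OF \<open>open V\<close>] y zw by blast
  have sub: "(s, t) \<in> V" if "s \<in> ball z R" "t \<in> ball w R" for s t
    using subsetD[OF R(2), of "(s, t)"] that by simp
  have "continuous (at (z, w)) (d2 2 f)"
    using sephol_d2_continuous_2[OF sh] \<open>open V\<close> y zw by (simp add: continuous_on_eq_continuous_at)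
  then have "continuous (at (z, w)) (\<lambda>p. blinfun_mult_right (d2 2 f p))"
    by (rule bounded_linear.continuous[OF bounded_linear_blinfun_mult_right])
  then have c: "continuous (at (z, w) within ball z R \<times> ball w R)
      (\<lambda>(s, t). blinfun_mult_right (d2 2 f (s, t)))"
    by (simp add: continuous_at_imp_continuous_at_within case_prod_unfold)
  have "((\<lambda>(s, t). f (s, t)) has_derivative (\<lambda>(u, v). d2 1 f (z, w) * u + blinfun_mult_right (d2 2 f (z, w)) v))
      (at (z, w) within ball z R \<times> ball w R)"
  proof (rule has_derivative_partialsI[OF _ _ c])
    show "((\<lambda>s. f (s, w)) has_derivative (*) (d2 1 f (z, w))) (at z within ball z R)"
      using hz[of z w] y zw by (simp add: has_field_derivative_def has_derivative_at_withinI)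
    show "((\<lambda>t. f (s, t)) has_derivative blinfun_mult_right (d2 2 f (s, t))) (at t within ball w R)"
      if "s \<in> ball z R" "t \<in> ball w R" for s t
      using hw[OF sub[OF that]] by (simp add: has_field_derivative_def has_derivative_at_withinI)
  qed (use R in auto)
  moreover have "at (z, w) within ball z R \<times> ball w R = at (z, w)"
    using R by (intro at_within_open open_Times) auto
  ultimately have "has_d2 f (d2 1 f (z, w)) (d2 2 f (z, w)) (z, w)"
    by (simp add: has_d2_def case_prod_unfold)
  then show "\<exists>a b. has_d2 f a b y" using zw by blast
qed

lemma holo2_d2_1: "holo2 f V \<Longrightarrow> holo2 (d2 (Suc 0) f) V"
  using sephol_imp_holo2[OF sephol_d2_1[OF holo2_imp_sephol]] by simp

lemma holo2_d2_2: "holo2 f V \<Longrightarrow> holo2 (d2 2 f) V"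
  by (rule sephol_imp_holo2[OF sephol_d2_2[OF holo2_imp_sephol]])

text \<open>Both mixed partials are limits of the same quotients of \<open>d2 2 f\<close> along
  1/(n+1): one by definition of the derivative, the other by \<open>sephol_mixed\<close>.\<close>

lemma d2_commute:
  assumes "holo2 f V" "y \<in> V"
  shows "d2 2 (d2 (Suc 0) f) y = d2 (Suc 0) (d2 2 f) y"
proof -
  obtain z w where zw: "y = (z, w)" by (cases y)
  let ?h = "\<lambda>n. inverse (of_nat (Suc n)) :: complex"
  have h0: "?h \<longlonglongrightarrow> 0"
    using LIMSEQ_inverse_real_of_nat
    by (subst tendsto_norm_zero_iff[symmetric]) (simp add: norm_inverse del: of_nat_Suc)
  have "filterlim ?h (at 0) sequentially"
    by (rule filterlim_atI[OF h0]) (auto simp del: of_nat_Suc)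
  moreover have "((\<lambda>t. d2 2 f (t, w)) has_field_derivative d2 1 (d2 2 f) (z, w)) (at z)"
    using has_d2_partials(1)[OF holo2_has_d2[OF holo2_d2_2[OF assms(1)] assms(2)]] zw by simp
  then have "((\<lambda>h. (d2 2 f (z + h, w) - d2 2 f (z, w)) / h) \<longlongrightarrow> d2 1 (d2 2 f) (z, w)) (at 0)"
    by (simp add: DERIV_def)
  ultimately have "(\<lambda>n. (d2 2 f (z + ?h n, w) - d2 2 f (z, w)) / ?h n) \<longlonglongrightarrow> d2 1 (d2 2 f) (z, w)"
    by (rule filterlim_compose[rotated])
  moreover obtain c where c: "((\<lambda>w. d2 1 f (z, w)) has_field_derivative c) (at w)"
    "(\<lambda>n. (d2 2 f (z + ?h n, w) - d2 2 f (z, w)) / ?h n) \<longlonglongrightarrow> c"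
    using sephol_mixed[OF holo2_imp_sephol[OF assms(1)]] assms(2) zw by blast
  ultimately have "c = d2 1 (d2 2 f) (z, w)"
    using LIMSEQ_unique by blast
  then show ?thesis using c(1) by (simp add: zw d2_def[of 2 "d2 (Suc 0) f"] DERIV_imp_deriv)
qed

section \<open>Flat connections preserving foliations\<close>

abbreviation dfst :: "(pt2 \<Rightarrow> complex) \<Rightarrow> pt2 \<Rightarrow> complex" where "dfst \<equiv> d2 (Suc 0)"
abbreviation dsnd :: "(pt2 \<Rightarrow> complex) \<Rightarrow> pt2 \<Rightarrow> complex" where "dsnd \<equiv> d2 2"

lemma holo2_has_d2_pair:
  assumes "holo2 F UNIV" "holo2 f V" "holo2 g V" "z \<in> V"
  shows "has_d2 (\<lambda>z. F (f z, g z)) (dfst F (f z, g z) * dfst f z + dsnd F (f z, g z) * dfst g z)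
    (dfst F (f z, g z) * dsnd f z + dsnd F (f z, g z) * dsnd g z) z"
  by (rule has_d2_pair[OF holo2_has_d2[OF assms(1)] holo2_has_d2[OF assms(2,4)] holo2_has_d2[OF assms(3,4)]]) simp

text \<open>Here gab and hab are the Christoffel symbols of the first and second coordinate. The hypotheses
  say that df is an eigenform, \<open>\<nabla> df = R df \<otimes> df\<close>; then \<open>R df\<close> is the connection form on a line
  subbundle of the cotangent bundle, and flatness makes it closed.\<close>

lemma flat_imp_multiplier_closed:
  assumes f: "holo2 f V" and y: "y \<in> V"
    and G: "holo2 g11 V" "holo2 g12 V" "holo2 g22 V" "holo2 h11 V" "holo2 h12 V" "holo2 h22 V"
    and R: "has_d2 R r1 r2 y"
    and f11: "\<And>z. z \<in> V \<Longrightarrow>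
      dfst (dfst f) z = g11 z * dfst f z + h11 z * dsnd f z + R z * (dfst f z * dfst f z)"
    and f12: "\<And>z. z \<in> V \<Longrightarrow>
      dfst (dsnd f) z = g12 z * dfst f z + h12 z * dsnd f z + R z * (dfst f z * dsnd f z)"
    and f22: "\<And>z. z \<in> V \<Longrightarrow>
      dsnd (dsnd f) z = g22 z * dfst f z + h22 z * dsnd f z + R z * (dsnd f z * dsnd f z)"
    and c11: "dfst g12 y - dsnd g11 y
      + (g12 y * g11 y - g11 y * g12 y + (h12 y * g12 y - h11 y * g22 y)) = 0"
    and c21: "dfst h12 y - dsnd h11 y
      + (g12 y * h11 y - g11 y * h12 y + (h12 y * h12 y - h11 y * h22 y)) = 0"
    and c12: "dfst g22 y - dsnd g12 y
      + (g22 y * g11 y - g12 y * g12 y + (h22 y * g12 y - h12 y * g22 y)) = 0"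
    and c22: "dfst h22 y - dsnd h12 y
      + (g22 y * h11 y - g12 y * h12 y + (h22 y * h12 y - h12 y * h22 y)) = 0"
    and nz: "dfst f y \<noteq> 0 \<or> dsnd f y \<noteq> 0"
  shows "r1 * dsnd f y = r2 * dfst f y"
proof -
  note V = holo2_open[OF f]
  define A where "A = dfst f"
  define B where "B = dsnd f"
  have hA: "holo2 A V" and hB: "holo2 B V"
    unfolding A_def B_def by (rule holo2_d2_1[OF f] holo2_d2_2[OF f])+
  note dA = holo2_has_d2[OF hA y] and dB = holo2_has_d2[OF hB y]
  note dG = G[THEN holo2_has_d2, OF y]
  have BA: "dsnd A z = dfst B z" if "z \<in> V" for z
    unfolding A_def B_def by (rule d2_commute[OF f that])
  have a1: "dfst A z = g11 z * A z + h11 z * B z + R z * (A z * A z)" if "z \<in> V" for z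
    using f11[OF that] by (simp add: A_def B_def)
  have b1: "dfst B z = g12 z * A z + h12 z * B z + R z * (A z * B z)" if "z \<in> V" for z
    using f12[OF that] by (simp add: A_def B_def)
  have a2: "dsnd A z = g12 z * A z + h12 z * B z + R z * (A z * B z)" if "z \<in> V" for z
    using b1[OF that] BA[OF that] by simp
  have b2: "dsnd B z = g22 z * A z + h22 z * B z + R z * (B z * B z)" if "z \<in> V" for z
    using f22[OF that] by (simp add: A_def B_def)
  have cong: "dfst F y = a \<and> dsnd F y = b"
    if "has_d2 E a b y" "\<And>z. z \<in> V \<Longrightarrow> F z = E z" for E F a b
    using has_d2_eqs[OF has_d2_cong[OF that(1) V y]] that(2) by auto
  note dRHS = has_d2_add[OF has_d2_add[OF has_d2_mult[OF _ dA] has_d2_mult[OF _ dB]]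
      has_d2_mult[OF R has_d2_mult]]
  have "dfst (dsnd A) y - dsnd (dfst A) y = 0" "dfst (dsnd B) y - dsnd (dfst B) y = 0"
    using d2_commute[OF hA y] d2_commute[OF hB y] by auto
  then have "(r1 * B y - r2 * A y) * A y = 0 \<and> (r1 * B y - r2 * A y) * B y = 0"
  proof -
    assume z1: "dfst (dsnd A) y - dsnd (dfst A) y = 0" and z2: "dfst (dsnd B) y - dsnd (dfst B) y = 0"
    \<comment> \<open>The Ricci identity for df: in the antisymmetrized second derivative the terms
      quadratic in R cancel, and what remains is dR wedge df, times df, plus the curvature applied
      to df.\<close>
    have "dfst (dsnd A) y - dsnd (dfst A) y = (r1 * B y - r2 * A y) * A y
      + (dfst g12 y - dsnd g11 y
          + (g12 y * g11 y - g11 y * g12 y + (h12 y * g12 y - h11 y * g22 y))) * A y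
      + (dfst h12 y - dsnd h11 y
          + (g12 y * h11 y - g11 y * h12 y + (h12 y * h12 y - h11 y * h22 y))) * B y"
      using conjunct2[OF cong[OF dRHS[OF dG(1) dG(4) dA dA] a1]]
        conjunct1[OF cong[OF dRHS[OF dG(2) dG(5) dA dB] a2]]
      by (simp only: a1[OF y] a2[OF y] b1[OF y] b2[OF y]) (simp add: algebra_simps)
    moreover have "dfst (dsnd B) y - dsnd (dfst B) y = (r1 * B y - r2 * A y) * B y
      + (dfst g22 y - dsnd g12 y
          + (g22 y * g11 y - g12 y * g12 y + (h22 y * g12 y - h12 y * g22 y))) * A y
      + (dfst h22 y - dsnd h12 y
          + (g22 y * h11 y - g12 y * h12 y + (h22 y * h12 y - h12 y * h22 y))) * B y"
      using conjunct2[OF cong[OF dRHS[OF dG(2) dG(5) dA dB] b1]]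
        conjunct1[OF cong[OF dRHS[OF dG(3) dG(6) dB dB] b2]]
      by (simp only: a1[OF y] a2[OF y] b1[OF y] b2[OF y]) (simp add: algebra_simps)
    ultimately show ?thesis
      unfolding c11 c21 c12 c22 z1 z2 by simp
  qed
  then show ?thesis using nz by (auto simp: A_def B_def)
qed

text \<open>A symmetric bilinear form annihilated by the kernel vector (q, -p) of the covector (p,
  q) is a multiple of the square of that covector. It is applied to (covariant) Hessians and
  produces the multipliers s and t.\<close>

lemma rank_one_symmetric:
  fixes p q :: complex
  assumes "q * h11 = p * h12" "q * h12 = p * h22" "p \<noteq> 0 \<or> q \<noteq> 0"
  obtains s where "h11 = s * (p * p)" "h12 = s * (p * q)" "h22 = s * (q * q)"
proof (cases "p = 0")
  case True
  then show ?thesis using assms by (intro that[of "h22 / (q * q)"]) auto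
next
  case False
  have h12: "h12 = q * h11 / p" using assms(1) False by (simp add: field_simps)
  have h22: "h22 = q * h12 / p" using assms(2) False by (simp add: field_simps)
  show ?thesis using False by (intro that[of "h11 / (p * p)"]) (auto simp: h12 h22)
qed

text \<open>Cramer's rule for the independent covectors df and dg: it separates the df-part of an
  identity between 1-forms from the dg-part.\<close>

lemma combination_zero:
  fixes p q u v :: complex
  assumes "a * p + b * u = 0" "a * q + b * v = 0" "p * v - q * u \<noteq> 0"
  shows "a = 0"
proof -
  have "a * (p * v - q * u) = (a * p + b * u) * v - (a * q + b * v) * u"
    by (simp add: algebra_simps)
  then show ?thesis using assms by simp
qed

text \<open>The area form is \<open>k df \<and> dg / L\<close>. Its parallelism identifies the multiplier of f with the
  f-derivative of log L. Only the square of L is required to be a function of (f, g), because for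
  a cubic that is quadratic in the eliminated variable L is the square root of a discriminant.\<close>

lemma flat_hess_imp_log_density_split:
  assumes f: "holo2 f V" and g: "holo2 g V" and L: "holo2 L V" and D: "holo2 D UNIV" and y: "y \<in> V"
    and J: "\<And>z. z \<in> V \<Longrightarrow> dfst f z * dsnd g z - dsnd f z * dfst g z \<noteq> 0"
    and Lnz: "\<And>z. z \<in> V \<Longrightarrow> L z \<noteq> 0"
    and LD: "\<And>z. z \<in> V \<Longrightarrow> L z * L z = D (f z, g z)"
    and W: "\<And>z. z \<in> V \<Longrightarrow> W z = k * ((dfst f z * dsnd g z - dsnd f z * dfst g z) / L z)" and k: "k \<noteq> 0"
    and G: "holo2 g11 V" "holo2 g12 V" "holo2 g22 V" "holo2 h11 V" "holo2 h12 V" "holo2 h22 V"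
    and W1: "\<And>z. z \<in> V \<Longrightarrow> dfst W z = (g11 z + h12 z) * W z"
    and W2: "\<And>z. z \<in> V \<Longrightarrow> dsnd W z = (g12 z + h22 z) * W z"
    and pf1: "\<And>z. z \<in> V \<Longrightarrow> dsnd f z * (dfst (dfst f) z - g11 z * dfst f z - h11 z * dsnd f z)
      = dfst f z * (dfst (dsnd f) z - g12 z * dfst f z - h12 z * dsnd f z)"
    and pf2: "\<And>z. z \<in> V \<Longrightarrow> dsnd f z * (dfst (dsnd f) z - g12 z * dfst f z - h12 z * dsnd f z)
      = dfst f z * (dsnd (dsnd f) z - g22 z * dfst f z - h22 z * dsnd f z)"
    and pg1: "\<And>z. z \<in> V \<Longrightarrow> dsnd g z * (dfst (dfst g) z - g11 z * dfst g z - h11 z * dsnd g z)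
      = dfst g z * (dfst (dsnd g) z - g12 z * dfst g z - h12 z * dsnd g z)"
    and pg2: "\<And>z. z \<in> V \<Longrightarrow> dsnd g z * (dfst (dsnd g) z - g12 z * dfst g z - h12 z * dsnd g z)
      = dfst g z * (dsnd (dsnd g) z - g22 z * dfst g z - h22 z * dsnd g z)"
    and c11: "dfst g12 y - dsnd g11 y
      + (g12 y * g11 y - g11 y * g12 y + (h12 y * g12 y - h11 y * g22 y)) = 0"
    and c21: "dfst h12 y - dsnd h11 y
      + (g12 y * h11 y - g11 y * h12 y + (h12 y * h12 y - h11 y * h22 y)) = 0"
    and c12: "dfst g22 y - dsnd g12 y
      + (g22 y * g11 y - g12 y * g12 y + (h22 y * g12 y - h12 y * g22 y)) = 0"
    and c22: "dfst h22 y - dsnd h12 y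
      + (g22 y * h11 y - g12 y * h12 y + (h22 y * h12 y - h12 y * h22 y)) = 0"
  shows "D (f y, g y) * dsnd (dfst D) (f y, g y) = dfst D (f y, g y) * dsnd D (f y, g y)"
proof -
  note V = holo2_open[OF f]
  \<comment> \<open>The f-derivative of log L, written as half that of log D because L itself need
    not be a function of (f, g).\<close>
  define R where "R z = dfst D (f z, g z) / (2 * D (f z, g z))" for z
  have Dnz: "D (f z, g z) \<noteq> 0" if "z \<in> V" for z
    using LD[OF that] Lnz[OF that] by auto
  have "dfst (dfst f) z - g11 z * dfst f z - h11 z * dsnd f z = R z * (dfst f z * dfst f z) \<and>
      dfst (dsnd f) z - g12 z * dfst f z - h12 z * dsnd f z = R z * (dfst f z * dsnd f z) \<and>
      dsnd (dsnd f) z - g22 z * dfst f z - h22 z * dsnd f z = R z * (dsnd f z * dsnd f z)"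
    if z: "z \<in> V" for z
  proof -
    define p q u v where "p = dfst f z" and "q = dsnd f z" and "u = dfst g z" and "v = dsnd g z"
    note defs = p_def q_def u_def v_def
    have j: "p * v - q * u \<noteq> 0" using J[OF z] by (simp add: defs)
    have nzf: "dfst f z \<noteq> 0 \<or> dsnd f z \<noteq> 0" and nzg: "dfst g z \<noteq> 0 \<or> dsnd g z \<noteq> 0"
      using J[OF z] by auto
    obtain s where "dfst (dfst f) z - g11 z * dfst f z - h11 z * dsnd f z = s * (dfst f z * dfst f z)"
      "dfst (dsnd f) z - g12 z * dfst f z - h12 z * dsnd f z = s * (dfst f z * dsnd f z)"
      "dsnd (dsnd f) z - g22 z * dfst f z - h22 z * dsnd f z = s * (dsnd f z * dsnd f z)"
      by (rule rank_one_symmetric[OF pf1[OF z] pf2[OF z] nzf])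
    note s = this[folded defs]
    obtain t where "dfst (dfst g) z - g11 z * dfst g z - h11 z * dsnd g z = t * (dfst g z * dfst g z)"
      "dfst (dsnd g) z - g12 z * dfst g z - h12 z * dsnd g z = t * (dfst g z * dsnd g z)"
      "dsnd (dsnd g) z - g22 z * dfst g z - h22 z * dsnd g z = t * (dsnd g z * dsnd g z)"
      by (rule rank_one_symmetric[OF pg1[OF z] pg2[OF z] nzg])
    note t = this[folded defs]
    have s': "dfst (dfst f) z = g11 z * p + h11 z * q + s * (p * p)"
      "dfst (dsnd f) z = g12 z * p + h12 z * q + s * (p * q)"
      "dsnd (dfst f) z = g12 z * p + h12 z * q + s * (p * q)"
      "dsnd (dsnd f) z = g22 z * p + h22 z * q + s * (q * q)"
      using s d2_commute[OF f z] by (simp_all add: algebra_simps)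
    have t': "dfst (dfst g) z = g11 z * u + h11 z * v + t * (u * u)"
      "dfst (dsnd g) z = g12 z * u + h12 z * v + t * (u * v)"
      "dsnd (dfst g) z = g12 z * u + h12 z * v + t * (u * v)"
      "dsnd (dsnd g) z = g22 z * u + h22 z * v + t * (v * v)"
      using t d2_commute[OF g z] by (simp_all add: algebra_simps)
    note df = holo2_has_d2[OF holo2_d2_1[OF f] z] holo2_has_d2[OF holo2_d2_2[OF f] z]
      holo2_has_d2[OF holo2_d2_1[OF g] z] holo2_has_d2[OF holo2_d2_2[OF g] z]
    note dJ = has_d2_diff[OF has_d2_mult[OF df(1) df(4)] has_d2_mult[OF df(2) df(3)]]
    note dW = has_d2_mult[OF has_d2_const[of k] has_d2_divide[OF dJ holo2_has_d2[OF L z] Lnz[OF z]]]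
    note dW' = has_d2_cong[OF dW V z W[symmetric]]
    note e = has_d2_eqs[OF dW', folded defs, unfolded s' t' W1[OF z] W2[OF z] W[OF z], folded defs]
    \<comment> \<open>The logarithmic derivative of W is the trace of the connection; that of the
      Jacobian is the same trace plus \<open>s df + t dg\<close>. As W is a constant times the
      Jacobian over L, the difference is d log L. The factor \<open>k * L z\<close> clears
      denominators.\<close>
    have e1: "dfst L z = L z * (s * p + t * u)"
    proof -
      have "k * L z * ((p * v - q * u) * (dfst L z - L z * (s * p + t * u))) = 0"
        using e(1) Lnz[OF z] by (simp add: field_simps power2_eq_square)
      then show ?thesis using j k Lnz[OF z] by simp
    qed
    have e2: "dsnd L z = L z * (s * q + t * v)"
    proof -
      have "k * L z * ((p * v - q * u) * (dsnd L z - L z * (s * q + t * v))) = 0"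
        using e(2) Lnz[OF z] by (simp add: field_simps power2_eq_square)
      then show ?thesis using j k Lnz[OF z] by simp
    qed
    have dD: "has_d2 (\<lambda>z. D (f z, g z)) (dfst D (f z, g z) * p + dsnd D (f z, g z) * u)
        (dfst D (f z, g z) * q + dsnd D (f z, g z) * v) z"
      unfolding defs by (rule holo2_has_d2_pair[OF D f g z])
    have dLL: "has_d2 (\<lambda>z. D (f z, g z)) (dfst L z * L z + L z * dfst L z) (dsnd L z * L z + L z * dsnd L z) z"
      by (rule has_d2_cong[OF has_d2_mult[OF holo2_has_d2[OF L z] holo2_has_d2[OF L z]] V z]) (rule LD)
    have "2 * (L z * L z) * (s * p + t * u) = dfst D (f z, g z) * p + dsnd D (f z, g z) * u"
      "2 * (L z * L z) * (s * q + t * v) = dfst D (f z, g z) * q + dsnd D (f z, g z) * v"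
      using has_d2_eqs[OF dD] has_d2_eqs[OF dLL] by (simp_all add: e1 e2 algebra_simps)
    then have "(2 * D (f z, g z) * s - dfst D (f z, g z)) * p + (2 * D (f z, g z) * t - dsnd D (f z, g z)) * u = 0"
      "(2 * D (f z, g z) * s - dfst D (f z, g z)) * q + (2 * D (f z, g z) * t - dsnd D (f z, g z)) * v = 0"
      by (simp_all add: LD[OF z] algebra_simps)
    from combination_zero[OF this j] have "s = R z"
      using Dnz[OF z] by (simp add: R_def field_simps)
    then show ?thesis using s by (simp add: defs)
  qed
  note H = this
  let ?F = "\<lambda>w. dfst D w / (2 * D w)"
  let ?a = "(f y, g y)"
  have "has_d2 D (dfst D ?a) (dsnd D ?a) ?a" "has_d2 (dfst D) (dfst (dfst D) ?a) (dsnd (dfst D) ?a) ?a"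
    using D holo2_d2_1[OF D] by (auto intro!: holo2_has_d2)
  from has_d2_divide[OF this(2) has_d2_mult[OF has_d2_const[of 2] this(1)]] Dnz[OF y]
  obtain A where F: "has_d2 ?F A ((dsnd (dfst D) ?a * (2 * D ?a) - dfst D ?a * (2 * dsnd D ?a)) / (2 * D ?a)\<^sup>2) ?a"
    by auto
  define B where "B = (dsnd (dfst D) ?a * (2 * D ?a) - dfst D ?a * (2 * dsnd D ?a)) / (2 * D ?a)\<^sup>2"
  have dR: "has_d2 R (A * dfst f y + B * dfst g y) (A * dsnd f y + B * dsnd g y) y"
    unfolding R_def B_def
    by (rule has_d2_pair[OF F holo2_has_d2[OF f y] holo2_has_d2[OF g y]])
  have "(A * dfst f y + B * dfst g y) * dsnd f y = (A * dsnd f y + B * dsnd g y) * dfst f y"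
  proof (rule flat_imp_multiplier_closed[OF f y G dR _ _ _ c11 c21 c12 c22])
    show "dfst f y \<noteq> 0 \<or> dsnd f y \<noteq> 0" using J[OF y] by auto
  qed (use H in \<open>simp_all add: diff_eq_eq algebra_simps\<close>)
  \<comment> \<open>R is a function of (f, g) with partial derivatives A and B, so dR wedge df keeps
    only the B-term: closedness of R df is the vanishing of a mixed derivative.\<close>
  then have "B * (dfst f y * dsnd g y - dsnd f y * dfst g y) = 0" by (auto simp: algebra_simps)
  then have "B = 0" using J[OF y] by simp
  then show ?thesis using Dnz[OF y] by (simp add: B_def algebra_simps)
qed

section \<open>Parallelizable webs: splitting of the slope of the third foliation\<close>

lemma proportional:
  fixes c1 c2 :: complex
  assumes "p * c2 = q * c1" "a * c2 = b * c1" "c1 \<noteq> 0 \<or> c2 \<noteq> 0"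
  shows "q * a = p * b"
proof (cases "c1 = 0")
  case True
  then show ?thesis using assms by simp
next
  case False
  then have "q = p * c2 / c1" "b = a * c2 / c1" using assms by (auto simp: field_simps)
  then show ?thesis by simp
qed

text \<open>The third foliation is the kernel of \<open>N df + M dg\<close>. The flat connection is the one of the
  parallelizing chart, and the multiplier of f is the f-derivative of log (M / N).\<close>

lemma parallel_web_imp_log_slope_split:
  assumes f: "holo2 f V" and g: "holo2 g V" and N: "holo2 N UNIV" and M: "holo2 M UNIV" and y: "y \<in> V"
    and J: "\<And>z. z \<in> V \<Longrightarrow> dfst f z * dsnd g z - dsnd f z * dfst g z \<noteq> 0"
    and NM: "\<And>z. z \<in> V \<Longrightarrow> N (f z, g z) \<noteq> 0" "\<And>z. z \<in> V \<Longrightarrow> M (f z, g z) \<noteq> 0"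
    and pf: "\<And>z. z \<in> V \<Longrightarrow> dfst f z * c2 = dsnd f z * c1" and c: "c1 \<noteq> 0 \<or> c2 \<noteq> 0"
    and pg: "\<And>z. z \<in> V \<Longrightarrow> dfst g z * e2 = dsnd g z * e1" and e: "e1 \<noteq> 0 \<or> e2 \<noteq> 0"
    and ph: "\<And>z. z \<in> V \<Longrightarrow> (N (f z, g z) * dfst f z + M (f z, g z) * dfst g z) * k2
      = (N (f z, g z) * dsnd f z + M (f z, g z) * dsnd g z) * k1" and k: "k1 \<noteq> 0 \<or> k2 \<noteq> 0"
  shows "(N (f y, g y))\<^sup>2 * (M (f y, g y) * dsnd (dfst M) (f y, g y) - dfst M (f y, g y) * dsnd M (f y, g y))
    = (M (f y, g y))\<^sup>2 * (N (f y, g y) * dsnd (dfst N) (f y, g y) - dfst N (f y, g y) * dsnd N (f y, g y))"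
proof -
  note V = holo2_open[OF f]
  have par: "dfst A z * r2 = dfst B z * r1 \<and> dsnd A z * r2 = dsnd B z * r1"
    if "\<And>z. z \<in> V \<Longrightarrow> A z * r2 = B z * r1" "holo2 A V" "holo2 B V" "z \<in> V" for A B r1 r2 z
  proof -
    note dA = has_d2_mult[OF holo2_has_d2[OF that(2,4)] has_d2_const[of r2]]
    note dB = has_d2_mult[OF holo2_has_d2[OF that(3,4)] has_d2_const[of r1]]
    from has_d2_eqs[OF has_d2_cong[OF dA V that(4,1)]] has_d2_eqs[OF dB] show ?thesis by simp
  qed
  \<comment> \<open>In the parallelizing chart dF is a multiple of a constant covector, hence so is
    each row of the Hessian of F; by symmetry the Hessian is a multiple of the square of dF.\<close>
  have mult: "\<exists>s. dfst (dfst F) z = s * (dfst F z * dfst F z) \<and> dfst (dsnd F) z = s * (dfst F z * dsnd F z) \<and>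
      dsnd (dsnd F) z = s * (dsnd F z * dsnd F z)"
    if F: "holo2 F V" and z: "z \<in> V" and pF: "\<And>z. z \<in> V \<Longrightarrow> dfst F z * r2 = dsnd F z * r1"
      and r: "r1 \<noteq> 0 \<or> r2 \<noteq> 0" and nz: "dfst F z \<noteq> 0 \<or> dsnd F z \<noteq> 0" for F z r1 r2
  proof -
    have "dfst (dfst F) z * r2 = dfst (dsnd F) z * r1 \<and> dsnd (dfst F) z * r2 = dsnd (dsnd F) z * r1"
      by (rule par[OF pF holo2_d2_1[OF F] holo2_d2_2[OF F] z])
    then have a: "dfst (dfst F) z * r2 = dfst (dsnd F) z * r1" "dfst (dsnd F) z * r2 = dsnd (dsnd F) z * r1"
      by (simp_all add: d2_commute[OF F z])
    show ?thesis
      by (rule rank_one_symmetric[OF proportional[OF pF[OF z] a(1) r] proportional[OF pF[OF z] a(2) r] nz])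
        blast
  qed
  define R where "R z = (dfst M (f z, g z) * N (f z, g z) - dfst N (f z, g z) * M (f z, g z))
      / (N (f z, g z) * M (f z, g z))" for z
  have H: "dfst (dfst f) z = R z * (dfst f z * dfst f z) \<and> dfst (dsnd f) z = R z * (dfst f z * dsnd f z) \<and>
      dsnd (dsnd f) z = R z * (dsnd f z * dsnd f z)" if z: "z \<in> V" for z
  proof -
    define p q u v where "p = dfst f z" and "q = dsnd f z" and "u = dfst g z" and "v = dsnd g z"
    note defs = p_def q_def u_def v_def
    have j: "p * v - q * u \<noteq> 0" using J[OF z] by (simp add: defs)
    have nzf: "dfst f z \<noteq> 0 \<or> dsnd f z \<noteq> 0" and nzg: "dfst g z \<noteq> 0 \<or> dsnd g z \<noteq> 0"
      using J[OF z] by auto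
    obtain s where s: "dfst (dfst f) z = s * (p * p)" "dfst (dsnd f) z = s * (p * q)"
      "dsnd (dsnd f) z = s * (q * q)"
      using mult[OF f z pf c nzf] unfolding defs by blast
    obtain t where t: "dfst (dfst g) z = t * (u * u)" "dfst (dsnd g) z = t * (u * v)"
      "dsnd (dsnd g) z = t * (v * v)"
      using mult[OF g z pg e nzg] unfolding defs by blast
    have st: "dsnd (dfst f) z = s * (p * q)" "dsnd (dfst g) z = t * (u * v)"
      using s t d2_commute[OF f z] d2_commute[OF g z] by auto
    define n m nx ny mx my where "n = N (f z, g z)" and "m = M (f z, g z)"
      and "nx = dfst N (f z, g z)" and "ny = dsnd N (f z, g z)"
      and "mx = dfst M (f z, g z)" and "my = dsnd M (f z, g z)"
    note defs' = n_def m_def nx_def ny_def mx_def my_def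
    note dN = holo2_has_d2_pair[OF N f g] and dM = holo2_has_d2_pair[OF M f g]
    note df = holo2_has_d2[OF holo2_d2_1[OF f]] holo2_has_d2[OF holo2_d2_2[OF f]]
      holo2_has_d2[OF holo2_d2_1[OF g]] holo2_has_d2[OF holo2_d2_2[OF g]]
    let ?X = "\<lambda>z. N (f z, g z) * dfst f z + M (f z, g z) * dfst g z"
    let ?Y = "\<lambda>z. N (f z, g z) * dsnd f z + M (f z, g z) * dsnd g z"
    note dX = has_d2_add[OF has_d2_mult[OF dN df(1)] has_d2_mult[OF dM df(3)]]
    note dY = has_d2_add[OF has_d2_mult[OF dN df(2)] has_d2_mult[OF dM df(4)]]
    have hX: "holo2 ?X V" by (rule holo2I[OF V]) (use dX in blast)
    have hY: "holo2 ?Y V" by (rule holo2I[OF V]) (use dY in blast)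
    note pXY = par[OF ph hX hY z]
    note eX = has_d2_eqs[OF dX[OF z z z z], folded defs defs', unfolded s t st]
    note eY = has_d2_eqs[OF dY[OF z z z z], folded defs defs', unfolded s t st]
    have q1: "?Y z * dfst ?X z = ?X z * dfst ?Y z" and q2: "?Y z * dsnd ?X z = ?X z * dsnd ?Y z"
      using proportional[OF ph[OF z] _ k] pXY by blast+
    \<comment> \<open>A 1-form proportional to a constant covector has derivatives proportional to
      it. Expanding this for \<open>n df + m dg\<close>, the Jacobian \<open>p * v - q * u\<close>
      factors out; what is left, divided by \<open>n * m\<close>, is the first component of d log (N
      / M) + s df - t dg.\<close>
    have "((nx * m + n * m * s - mx * n) * p + (ny * m - my * n - n * m * t) * u) * (p * v - q * u) = 0"
      using q1 unfolding eX(1) eY(1) unfolding defs[symmetric] defs'[symmetric] by (simp add: algebra_simps)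
    then have r1: "(nx * m + n * m * s - mx * n) * p + (ny * m - my * n - n * m * t) * u = 0"
      using j by (simp only: mult_eq_0_iff) simp
    have "((nx * m + n * m * s - mx * n) * q + (ny * m - my * n - n * m * t) * v) * (p * v - q * u) = 0"
      using q2 unfolding eX(2) eY(2) unfolding defs[symmetric] defs'[symmetric] by (simp add: algebra_simps)
    then have r2: "(nx * m + n * m * s - mx * n) * q + (ny * m - my * n - n * m * t) * v = 0"
      using j by (simp only: mult_eq_0_iff) simp
    have "s = R z"
      using combination_zero[OF r1 r2 j] NM[OF z] by (simp add: R_def defs' field_simps)
    then show ?thesis using s by (simp add: defs)
  qed
  let ?F = "\<lambda>w. (dfst M w * N w - dfst N w * M w) / (N w * M w)"
  let ?a = "(f y, g y)"
  have d: "has_d2 N (dfst N ?a) (dsnd N ?a) ?a" "has_d2 M (dfst M ?a) (dsnd M ?a) ?a"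
    "has_d2 (dfst N) (dfst (dfst N) ?a) (dsnd (dfst N) ?a) ?a"
    "has_d2 (dfst M) (dfst (dfst M) ?a) (dsnd (dfst M) ?a) ?a"
    using N M holo2_d2_1[OF N] holo2_d2_1[OF M] by (auto intro!: holo2_has_d2)
  define B where "B = ((dsnd (dfst M) ?a * N ?a + dfst M ?a * dsnd N ?a
      - (dsnd (dfst N) ?a * M ?a + dfst N ?a * dsnd M ?a)) * (N ?a * M ?a)
      - (dfst M ?a * N ?a - dfst N ?a * M ?a) * (dsnd N ?a * M ?a + N ?a * dsnd M ?a)) / (N ?a * M ?a)\<^sup>2"
  obtain A where F: "has_d2 ?F A B ?a"
    using has_d2_divide[OF has_d2_diff[OF has_d2_mult[OF d(4) d(1)] has_d2_mult[OF d(3) d(2)]]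
        has_d2_mult[OF d(1,2)]] NM[OF y] unfolding B_def by auto
  have dR: "has_d2 R (A * dfst f y + B * dfst g y) (A * dsnd f y + B * dsnd g y) y"
    unfolding R_def
    by (rule has_d2_pair[OF F holo2_has_d2[OF f y] holo2_has_d2[OF g y]])
  have h0: "holo2 (\<lambda>z. 0) V" by (rule holo2I[OF V]) (use has_d2_const in blast)
  have z0: "dfst (\<lambda>z. 0) y = 0" "dsnd (\<lambda>z. 0) y = 0"
    using has_d2_eqs[OF has_d2_const[of 0 y]] by auto
  have "(A * dfst f y + B * dfst g y) * dsnd f y = (A * dsnd f y + B * dsnd g y) * dfst f y"
  proof (rule flat_imp_multiplier_closed[OF f y h0 h0 h0 h0 h0 h0 dR])
    show "dfst f y \<noteq> 0 \<or> dsnd f y \<noteq> 0" using J[OF y] by auto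
  qed (use H in \<open>simp_all add: z0\<close>)
  then have "B * (dfst f y * dsnd g y - dsnd f y * dfst g y) = 0" by (auto simp: algebra_simps)
  then have "B = 0" using J[OF y] by simp
  then show ?thesis using NM[OF y] by (simp add: B_def power2_eq_square algebra_simps)
qed

section \<open>Charts and Hess connections of cubics\<close>

lemma coord_simps [simp]:
  "coord (Suc 0) x = fst x" "coord 2 x = fst (snd x)" "coord 3 x = snd (snd x)"
  by (simp_all add: coord_def)

lemma dvec_eq:
  "dvec a phi y = (d2 a (\<lambda>z. fst (phi z)) y, d2 a (\<lambda>z. fst (snd (phi z))) y, d2 a (\<lambda>z. snd (snd (phi z))) y)"
  by (simp add: dvec_def)

text \<open>All cubics of the list are of this form, which is affine in the third variable.\<close>

definition cub :: "complex \<Rightarrow> complex \<Rightarrow> complex \<Rightarrow> complex \<Rightarrow> complex \<Rightarrow> complex \<Rightarrow> pt3 \<Rightarrow> complex" where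
  "cub c e1 e2 a b d = (\<lambda>(x, y, z). x * y * z - c * z + e1 * x\<^sup>2 + e2 * y\<^sup>2 + a * x + b * y + d)"

lemma pdP_cub:
  "pdP (cub c e1 e2 a b d) (Suc 0) p = fst (snd p) * snd (snd p) + 2 * e1 * fst p + a"
  "pdP (cub c e1 e2 a b d) 2 p = fst p * snd (snd p) + 2 * e2 * fst (snd p) + b"
  "pdP (cub c e1 e2 a b d) 3 p = fst p * fst (snd p) - c"
proof -
  obtain x y z where p: "p = (x, y, z)" by (cases p)
  have "((\<lambda>t. cub c e1 e2 a b d (t, y, z)) has_field_derivative y * z + 2 * e1 * x + a) (at x)"
    "((\<lambda>t. cub c e1 e2 a b d (x, t, z)) has_field_derivative x * z + 2 * e2 * y + b) (at y)"
    "((\<lambda>t. cub c e1 e2 a b d (x, y, t)) has_field_derivative x * y - c) (at z)"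
    by (auto simp: cub_def intro!: derivative_eq_intros)
  from this[THEN DERIV_imp_deriv]
  show "pdP (cub c e1 e2 a b d) (Suc 0) p = fst (snd p) * snd (snd p) + 2 * e1 * fst p + a"
    "pdP (cub c e1 e2 a b d) 2 p = fst p * snd (snd p) + 2 * e2 * fst (snd p) + b"
    "pdP (cub c e1 e2 a b d) 3 p = fst p * fst (snd p) - c"
    by (simp_all add: pdP_def upd3_def p)
qed

text \<open>Where one partial derivative of P (here C) is nonzero, the corresponding component of a
  tangent vector is determined by the other two, so the remaining two coordinate functions are
  independent. For the pair (1,3) it is applied with the variables permuted.\<close>

lemma jacobian_nonzero:
  fixes x1 x2 y1 y2 z1 z2 :: complex
  assumes indep: "\<And>c1 c2. c1 * x1 + c2 * x2 = 0 \<Longrightarrow> c1 * y1 + c2 * y2 = 0 \<Longrightarrow> c1 * z1 + c2 * z2 = 0 \<Longrightarrow>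
      c1 = 0 \<and> c2 = 0"
    and rel: "A * x1 + B * y1 + C * z1 = 0" "A * x2 + B * y2 + C * z2 = 0" and "C \<noteq> 0"
  shows "x1 * y2 - x2 * y1 \<noteq> 0"
proof
  assume j: "x1 * y2 - x2 * y1 = 0"
  have z: "c1 * z1 + c2 * z2 = 0" if "c1 * x1 + c2 * x2 = 0" "c1 * y1 + c2 * y2 = 0" for c1 c2
  proof -
    have "C * (c1 * z1 + c2 * z2) = c1 * (A * x1 + B * y1 + C * z1) + c2 * (A * x2 + B * y2 + C * z2)
        - A * (c1 * x1 + c2 * x2) - B * (c1 * y1 + c2 * y2)"
      by (simp add: algebra_simps)
    then show ?thesis using that rel \<open>C \<noteq> 0\<close> by simp
  qed
  have ind: "c1 = 0 \<and> c2 = 0" if "c1 * x1 + c2 * x2 = 0" "c1 * y1 + c2 * y2 = 0" for c1 c2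
    using indep z that by blast
  \<comment> \<open>If the determinant vanishes, (x2, -x1) and (y2, -y1) are linear relations, hence
    zero; then (1, 1) is a nontrivial relation.\<close>
  have "x2 = 0 \<and> - x1 = 0" using j by (intro ind) (auto simp: algebra_simps)
  moreover have "y2 = 0 \<and> - y1 = 0" using j by (intro ind) (auto simp: algebra_simps)
  ultimately show False using ind[of 1 1] by simp
qed

lemma cub_chart:
  assumes ch: "hol_chart U phi V p" and U: "U \<subseteq> surf (cub c e1 e2 a b d)"
  defines "X \<equiv> \<lambda>z. fst (phi z)" and "Y \<equiv> \<lambda>z. fst (snd (phi z))" and "Z \<equiv> \<lambda>z. snd (snd (phi z))"
  shows "holo2 X V" "holo2 Y V" "holo2 Z V"
    and "z \<in> V \<Longrightarrow> cub c e1 e2 a b d (X z, Y z, Z z) = 0"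
    and "z \<in> V \<Longrightarrow> (Y z * Z z + 2 * e1 * X z + a) * dfst X z + (X z * Z z + 2 * e2 * Y z + b) * dfst Y z
        + (X z * Y z - c) * dfst Z z = 0"
    and "z \<in> V \<Longrightarrow> (Y z * Z z + 2 * e1 * X z + a) * dsnd X z + (X z * Z z + 2 * e2 * Y z + b) * dsnd Y z
        + (X z * Y z - c) * dsnd Z z = 0"
    and "z \<in> V \<Longrightarrow> c1 * dfst X z + c2 * dsnd X z = 0 \<Longrightarrow> c1 * dfst Y z + c2 * dsnd Y z = 0 \<Longrightarrow>
        c1 * dfst Z z + c2 * dsnd Z z = 0 \<Longrightarrow> c1 = 0 \<and> c2 = 0"
proof -
  show h: "holo2 X V" "holo2 Y V" "holo2 Z V"
    using ch unfolding hol_chart_def X_def Y_def Z_def by simp_all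
  have "phi ` V \<subseteq> U" using ch by (simp add: hol_chart_def)
  then show eq: "cub c e1 e2 a b d (X z, Y z, Z z) = 0" if "z \<in> V" for z
    using U that by (auto simp: surf_def X_def Y_def Z_def)
  show "c1 = 0 \<and> c2 = 0" if "z \<in> V" "c1 * dfst X z + c2 * dsnd X z = 0" "c1 * dfst Y z + c2 * dsnd Y z = 0"
      "c1 * dfst Z z + c2 * dsnd Z z = 0" for z
  proof -
    have "\<forall>y\<in>V. \<forall>c1 c2. (\<forall>i\<in>{1,2,3}. c1 * coord i (dvec 1 phi y) + c2 * coord i (dvec 2 phi y) = 0)
        \<longrightarrow> c1 = 0 \<and> c2 = 0"
      using ch unfolding hol_chart_def by (elim conjE)
    from this[THEN bspec, OF that(1), THEN spec, THEN spec, of c1 c2] show ?thesis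
      using that(2-) by (simp add: dvec_eq X_def Y_def Z_def)
  qed
  have d1: "has_d2 (\<lambda>z. cub c e1 e2 a b d (X z, Y z, Z z))
      ((Y z * Z z + 2 * e1 * X z + a) * dfst X z + (X z * Z z + 2 * e2 * Y z + b) * dfst Y z
        + (X z * Y z - c) * dfst Z z)
      ((Y z * Z z + 2 * e1 * X z + a) * dsnd X z + (X z * Z z + 2 * e2 * Y z + b) * dsnd Y z
        + (X z * Y z - c) * dsnd Z z) z" if z: "z \<in> V" for z
    unfolding cub_def prod.case power2_eq_square
    by (rule has_d2_eq, (rule has_d2_intros holo2_has_d2[OF h(1) z] holo2_has_d2[OF h(2) z]
        holo2_has_d2[OF h(3) z])+) (simp_all add: algebra_simps)
  \<comment> \<open>The composite vanishes identically on the chart; comparing with the chain rule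
    in \<open>d1\<close> yields the tangency relations.\<close>
  have d0: "has_d2 (\<lambda>z. cub c e1 e2 a b d (X z, Y z, Z z)) 0 0 z" if z: "z \<in> V" for z
    by (rule has_d2_cong[OF has_d2_const holo2_open[OF h(1)] z, of 0]) (simp add: eq)
  show "(Y z * Z z + 2 * e1 * X z + a) * dfst X z + (X z * Z z + 2 * e2 * Y z + b) * dfst Y z
        + (X z * Y z - c) * dfst Z z = 0"
    and "(Y z * Z z + 2 * e1 * X z + a) * dsnd X z + (X z * Z z + 2 * e2 * Y z + b) * dsnd Y z
        + (X z * Y z - c) * dsnd Z z = 0" if "z \<in> V"
    using has_d2_eqs[OF d1[OF that]] has_d2_eqs[OF d0[OF that]] by simp_all
qed

lemma Omega_self: "Omega P x u u = 0"
  by (simp add: Omega_def)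

text \<open>Preservation is tested on the holomorphic field T = (- f_2, f_1), which lies in the
  kernel of df. Since df(T) = 0, the condition that df kills the covariant derivative of T along e_a
  says that the covariant Hessian of f annihilates the pair (e_a, T); the two equations are a = 1
  and a = 2.\<close>

lemma hess_conn_preserves:
  assumes hc: "is_hess_conn P i j phi V Gam" and k: "k \<in> {i, j}"
    and f: "holo2 f V" "\<And>z. f z = coord k (phi z)" and z: "z \<in> V"
  shows "dsnd f z * (dfst (dfst f) z - Gam 1 1 1 z * dfst f z - Gam 2 1 1 z * dsnd f z)
      = dfst f z * (dfst (dsnd f) z - Gam 1 1 2 z * dfst f z - Gam 2 1 2 z * dsnd f z)"
    and "dsnd f z * (dfst (dsnd f) z - Gam 1 1 2 z * dfst f z - Gam 2 1 2 z * dsnd f z)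
      = dfst f z * (dsnd (dsnd f) z - Gam 1 2 2 z * dfst f z - Gam 2 2 2 z * dsnd f z)"
proof -
  have f_eq: "(\<lambda>z. coord k (phi z)) = f" using f(2) by auto
  have sym: "Gam (Suc 0) 2 (Suc 0) z = Gam (Suc 0) (Suc 0) 2 z" "Gam 2 2 (Suc 0) z = Gam 2 (Suc 0) 2 z"
    using hc[unfolded is_hess_conn_def, THEN conjunct2, THEN conjunct1, rule_format, OF _ _ _ z] by simp_all
  define T where "T n = (if n = 1 then (\<lambda>z. 0 - dsnd f z) else dfst f)" for n :: nat
  have dT: "has_d2 (\<lambda>z. 0 - dsnd f z) (0 - dfst (dsnd f) z) (0 - dsnd (dsnd f) z) z" if "z \<in> V" for z
    by (rule has_d2_diff[OF has_d2_const holo2_has_d2[OF holo2_d2_2[OF f(1)] that]])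
  have "holo2 (\<lambda>z. 0 - dsnd f z) V"
    by (rule holo2I[OF holo2_open[OF f(1)]]) (use dT in blast)
  then have "holo2 (T 1) V \<and> holo2 (T 2) V \<and> (\<forall>y\<in>V. tangent_fol phi k y (T 1 y) (T 2 y))"
    using holo2_d2_1[OF f(1)] by (simp add: T_def tangent_fol_def f_eq)
  moreover have "\<forall>Y. holo2 (Y 1) V \<and> holo2 (Y 2) V \<and> (\<forall>y\<in>V. tangent_fol phi k y (Y 1 y) (Y 2 y)) \<longrightarrow>
      (\<forall>a\<in>{1,2}. \<forall>y\<in>V. tangent_fol phi k y (cov_deriv Gam a Y 1 y) (cov_deriv Gam a Y 2 y))"
    using hc k unfolding is_hess_conn_def by blast
  ultimately have t: "\<forall>a\<in>{1,2}. tangent_fol phi k z (cov_deriv Gam a T 1 z) (cov_deriv Gam a T 2 z)"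
    using z by blast
  note e = has_d2_eqs[OF dT[OF z]]
  have t1: "dfst f z * (0 - dfst (dsnd f) z + (Gam 1 1 1 z * (0 - dsnd f z) + Gam 1 1 2 z * dfst f z))
      + dsnd f z * (dfst (dfst f) z + (Gam 2 1 1 z * (0 - dsnd f z) + Gam 2 1 2 z * dfst f z)) = 0"
    using bspec[OF t, of 1] e by (simp add: tangent_fol_def cov_deriv_def f_eq T_def)
  have t2: "dfst f z * (0 - dsnd (dsnd f) z + (Gam 1 2 1 z * (0 - dsnd f z) + Gam 1 2 2 z * dfst f z))
      + dsnd f z * (dsnd (dfst f) z + (Gam 2 2 1 z * (0 - dsnd f z) + Gam 2 2 2 z * dfst f z)) = 0"
    using bspec[OF t, of 2] e by (simp add: tangent_fol_def cov_deriv_def f_eq T_def)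
  show "dsnd f z * (dfst (dfst f) z - Gam 1 1 1 z * dfst f z - Gam 2 1 1 z * dsnd f z)
      = dfst f z * (dfst (dsnd f) z - Gam 1 1 2 z * dfst f z - Gam 2 1 2 z * dsnd f z)"
    by (rule eq_iff_diff_eq_0[THEN iffD2], subst t1[symmetric]) (simp add: algebra_simps)
  show "dsnd f z * (dfst (dsnd f) z - Gam 1 1 2 z * dfst f z - Gam 2 1 2 z * dsnd f z)
      = dfst f z * (dsnd (dsnd f) z - Gam 1 2 2 z * dfst f z - Gam 2 2 2 z * dsnd f z)"
    by (rule eq_iff_diff_eq_0[THEN iffD2], subst t2[symmetric])
      (simp add: sym d2_commute[OF f(1) z] algebra_simps)
qed

text \<open>Passage from the tensorial conditions to components: in dimension two the area form has
  the single component W, its parallelism says that d log W is the trace of the connection, and the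
  curvature is determined by (a, b) = (1, 2). Vanishing torsion identifies the lower indices 12 and
  21.\<close>

lemma flat_hess_conn_imp:
  assumes hc: "is_hess_conn P i j phi V Gam"
    and flat: "\<forall>y\<in>V. \<forall>a\<in>{1,2}. \<forall>b\<in>{1,2}. \<forall>c\<in>{1,2}. \<forall>d\<in>{1,2}. curv Gam d c a b y = 0"
    and f: "holo2 f V" "\<And>z. f z = coord i (phi z)" and g: "holo2 g V" "\<And>z. g z = coord j (phi z)"
    and L: "holo2 L V" and D: "holo2 D UNIV" and y: "y \<in> V"
    and J: "\<And>z. z \<in> V \<Longrightarrow> dfst f z * dsnd g z - dsnd f z * dfst g z \<noteq> 0"
    and Lnz: "\<And>z. z \<in> V \<Longrightarrow> L z \<noteq> 0"
    and LD: "\<And>z. z \<in> V \<Longrightarrow> L z * L z = D (f z, g z)"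
    and W: "\<And>z. z \<in> V \<Longrightarrow> Omega P (phi z) (dvec 1 phi z) (dvec 2 phi z) =
        k * ((dfst f z * dsnd g z - dsnd f z * dfst g z) / L z)" and k: "k \<noteq> 0"
  shows "D (f y, g y) * dsnd (dfst D) (f y, g y) = dfst D (f y, g y) * dsnd D (f y, g y)"
proof -
  have hG: "holo2 (Gam (Suc 0) (Suc 0) (Suc 0)) V" "holo2 (Gam (Suc 0) (Suc 0) 2) V" "holo2 (Gam (Suc 0) 2 2) V"
    "holo2 (Gam 2 (Suc 0) (Suc 0)) V" "holo2 (Gam 2 (Suc 0) 2) V" "holo2 (Gam 2 2 2) V"
    using hc[unfolded is_hess_conn_def, THEN conjunct1, rule_format] by simp_all
  have sym: "Gam (Suc 0) 2 (Suc 0) z = Gam (Suc 0) (Suc 0) 2 z" "Gam 2 2 (Suc 0) z = Gam 2 (Suc 0) 2 z"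
    if "z \<in> V" for z
    using hc[unfolded is_hess_conn_def, THEN conjunct2, THEN conjunct1, rule_format, OF _ _ _ that] by simp_all
  have dsym: "dfst (Gam (Suc 0) 2 (Suc 0)) y = dfst (Gam (Suc 0) (Suc 0) 2) y"
    "dfst (Gam 2 2 (Suc 0)) y = dfst (Gam 2 (Suc 0) 2) y"
    using has_d2_eqs(1)[OF has_d2_cong[OF holo2_has_d2[OF hG(2) y] holo2_open[OF f(1)] y sym(1)[symmetric]]]
      has_d2_eqs(1)[OF has_d2_cong[OF holo2_has_d2[OF hG(5) y] holo2_open[OF f(1)] y sym(2)[symmetric]]]
    by simp_all
  define w where "w = (\<lambda>z. Omega P (phi z) (dvec (Suc 0) phi z) (dvec 2 phi z))"
  have om: "d2 r (\<lambda>z. Omega P (phi z) (dvec 1 phi z) (dvec 2 phi z)) z =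
      (\<Sum>e\<in>{1,2}. Gam e r 1 z * Omega P (phi z) (dvec e phi z) (dvec 2 phi z)) +
      (\<Sum>e\<in>{1,2}. Gam e r 2 z * Omega P (phi z) (dvec 1 phi z) (dvec e phi z))"
    if "z \<in> V" "r \<in> {1, 2}" for z r
    using hc that unfolding is_hess_conn_def by blast
  have w1: "dfst w z = (Gam (Suc 0) (Suc 0) (Suc 0) z + Gam 2 (Suc 0) 2 z) * w z"
    and w2: "dsnd w z = (Gam (Suc 0) (Suc 0) 2 z + Gam 2 2 2 z) * w z" if "z \<in> V" for z
    using om[OF that, of 1] om[OF that, of 2] sym[OF that]
    by (simp_all add: w_def Omega_self algebra_simps)
  note pf = hess_conn_preserves[OF hc _ f, simplified] and pg = hess_conn_preserves[OF hc _ g, simplified]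
  have cu: "dfst (Gam q 2 r) y - dsnd (Gam q (Suc 0) r) y
      + (Gam (Suc 0) 2 r y * Gam q (Suc 0) (Suc 0) y - Gam (Suc 0) (Suc 0) r y * Gam q 2 (Suc 0) y
      + (Gam 2 2 r y * Gam q (Suc 0) 2 y - Gam 2 (Suc 0) r y * Gam q 2 2 y)) = 0"
    if "q \<in> {1, 2}" "r \<in> {1, 2}" for q r
  proof -
    have "curv Gam q r 1 2 y = 0" using flat y that by blast
    then show ?thesis by (simp add: curv_def)
  qed
  have W': "w z = k * ((dfst f z * dsnd g z - dsnd f z * dfst g z) / L z)" if "z \<in> V" for z
    using W[OF that] by (simp add: w_def)
  show ?thesis
    by (rule flat_hess_imp_log_density_split[OF f(1) g(1) L D y J Lnz LD W' k hG w1 w2 pf pg])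
      (use cu[of 1 1] cu[of 1 2] cu[of 2 1] cu[of 2 2] in \<open>simp_all add: dsym sym[OF y]\<close>)
qed

section \<open>Necessary conditions for a cubic to be Hess-flat or to carry a parallelizable
  web\<close>

lemma cub_hess_flat_12:
  assumes fl: "hess_flat (cub c e1 e2 a b d) 1 2" and p: "(x, y, z) \<in> pair_region (cub c e1 e2 a b d) 1 2"
  shows "c = 0"
proof -
  let ?P = "cub c e1 e2 a b d"
  obtain phi V Gam where ch: "hol_chart (pair_region ?P 1 2) phi V (x, y, z)"
    and hc: "is_hess_conn ?P 1 2 phi V Gam"
    and cv: "\<forall>y\<in>V. \<forall>a\<in>{1,2}. \<forall>b\<in>{1,2}. \<forall>c\<in>{1,2}. \<forall>d\<in>{1,2}. curv Gam d c a b y = 0"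
    using bspec[OF fl[unfolded hess_flat_def] p] by blast
  have U: "pair_region ?P 1 2 \<subseteq> surf ?P" by (auto simp: pair_region_def)
  note C = cub_chart[OF ch U]
  let ?X = "\<lambda>z. fst (phi z)" and ?Y = "\<lambda>z. fst (snd (phi z))"
  let ?L = "\<lambda>z. ?X z * ?Y z - c"
  obtain t where t: "t \<in> V" "phi t = (x, y, z)" using ch by (auto simp: hol_chart_def)
  have L: "?L s \<noteq> 0" if "s \<in> V" for s
  proof -
    have "phi s \<in> pair_region ?P 1 2" using ch that by (auto simp: hol_chart_def)
    then show ?thesis by (simp add: pair_region_def pdP_cub)
  qed
  \<comment> \<open>Here L = P_{x_3} is already a function of (x, y), so D is its plain square, and
    D D_xy - D_x D_y equals - 2 c L^2.\<close>
  let ?D = "\<lambda>w. (fst w * snd w - c) * (fst w * snd w - c)"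
  have dD: "has_d2 ?D (2 * snd w * (fst w * snd w - c)) (2 * fst w * (fst w * snd w - c)) w" for w
    by (rule has_d2_eq, (rule has_d2_intros)+) (simp_all add: algebra_simps)
  have D: "holo2 ?D UNIV" by (rule holo2I[OF open_UNIV]) (use dD in blast)
  have Dx: "dfst ?D = (\<lambda>w. 2 * snd w * (fst w * snd w - c))" and Dy: "dsnd ?D = (\<lambda>w. 2 * fst w * (fst w * snd w - c))"
    using has_d2_eqs[OF dD] by auto
  have "has_d2 (dfst ?D) (2 * snd w * snd w) (2 * (fst w * snd w - c) + 2 * fst w * snd w) w" for w
    unfolding Dx by (rule has_d2_eq, (rule has_d2_intros)+) (simp_all add: algebra_simps)
  from has_d2_eqs[OF this] have Dxy: "dsnd (dfst ?D) w = 2 * (fst w * snd w - c) + 2 * fst w * snd w" for w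
    by simp
  have hL: "holo2 ?L V"
    by (rule holo2I[OF holo2_open[OF C(1)]])
      (use has_d2_diff[OF has_d2_mult[OF holo2_has_d2[OF C(1)] holo2_has_d2[OF C(2)]] has_d2_const] in blast)
  have "?D (?X t, ?Y t) * dsnd (dfst ?D) (?X t, ?Y t) = dfst ?D (?X t, ?Y t) * dsnd ?D (?X t, ?Y t)"
  proof (rule flat_hess_conn_imp[OF hc cv C(1) _ C(2) _ hL D t(1) _ L, of 1])
    show "dfst ?X s * dsnd ?Y s - dsnd ?X s * dfst ?Y s \<noteq> 0" if "s \<in> V" for s
      by (rule jacobian_nonzero[OF C(7)[OF that] C(5)[OF that] C(6)[OF that] L[OF that]])
    show "Omega ?P (phi s) (dvec 1 phi s) (dvec 2 phi s) =
        1 * ((dfst ?X s * dsnd ?Y s - dsnd ?X s * dfst ?Y s) / ?L s)" if "s \<in> V" for s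
      using L[OF that] by (simp add: Omega_def pdP_cub dvec_eq mult.commute)
  qed simp_all
  then have "(x * y - c) * (x * y - c) * (2 * c) = 0"
    unfolding Dxy unfolding Dx Dy by (auto simp: t(2) algebra_simps)
  moreover have "x * y - c \<noteq> 0" using L[OF t(1)] t(2) by simp
  ultimately show ?thesis by simp
qed

text \<open>\<open>Omega\<close> takes the first nonvanishing partial derivative in the order 3, 1,
  2, whereas transversality of the pair (1,3) guarantees P_{x_2}. On tangent vectors the quotients
  agree, as one sees by solving the tangency relations for the second components.\<close>

lemma Omega_13:
  assumes rel: "pdP P 1 x * fst u + pdP P 2 x * fst (snd u) + pdP P 3 x * snd (snd u) = 0"
    "pdP P 1 x * fst v + pdP P 2 x * fst (snd v) + pdP P 3 x * snd (snd v) = 0"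
    and nz: "pdP P 2 x \<noteq> 0"
  shows "Omega P x u v = (snd (snd u) * fst v - fst u * snd (snd v)) / pdP P 2 x"
proof -
  define A B C where "A = pdP P 1 x" and "B = pdP P 2 x" and "C = pdP P 3 x"
  obtain u1 u2 u3 v1 v2 v3 where uv: "u = (u1, u2, u3)" "v = (v1, v2, v3)" by (metis prod_cases3)
  have r: "A * u1 + B * u2 + C * u3 = 0" "A * v1 + B * v2 + C * v3 = 0" and "B \<noteq> 0"
    using rel nz by (simp_all add: A_def B_def C_def uv)
  have u2: "u2 = - (A * u1 + C * u3) / B" and v2: "v2 = - (A * v1 + C * v3) / B"
    using r \<open>B \<noteq> 0\<close> by (simp_all add: field_simps add_eq_0_iff)
  show ?thesis
    unfolding Omega_def A_def[symmetric] B_def[symmetric] C_def[symmetric] uv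
    using \<open>B \<noteq> 0\<close> by (simp add: u2 v2 field_simps)
qed

text \<open>For \<open>c = 0\<close> the cubic is a polynomial in y with coefficients e2, x z + b
  and e1 x^2 + a x + d. On the surface the square of P_{x_2} is its discriminant D, and the
  expression in the conclusion is D D_xz - D_x D_z.\<close>

lemma cub_hess_flat_13:
  assumes fl: "hess_flat (cub 0 e1 e2 a b d) 1 3" and p: "(x, y, z) \<in> pair_region (cub 0 e1 e2 a b d) 1 3"
  shows "2 * b * (x * z + b)\<^sup>2 - 8 * e2 * (x * z + b) * (a * x + 2 * d) + 8 * b * e2 * (e1 * x\<^sup>2 + a * x + d) = 0"
proof -
  let ?P = "cub 0 e1 e2 a b d"
  obtain phi V Gam where ch: "hol_chart (pair_region ?P 1 3) phi V (x, y, z)"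
    and hc: "is_hess_conn ?P 1 3 phi V Gam"
    and cv: "\<forall>y\<in>V. \<forall>a\<in>{1,2}. \<forall>b\<in>{1,2}. \<forall>c\<in>{1,2}. \<forall>d\<in>{1,2}. curv Gam d c a b y = 0"
    using bspec[OF fl[unfolded hess_flat_def] p] by blast
  have U: "pair_region ?P 1 3 \<subseteq> surf ?P" by (auto simp: pair_region_def)
  note C = cub_chart[OF ch U]
  let ?X = "\<lambda>z. fst (phi z)" and ?Y = "\<lambda>z. fst (snd (phi z))" and ?Z = "\<lambda>z. snd (snd (phi z))"
  let ?L = "\<lambda>z. ?X z * ?Z z + 2 * e2 * ?Y z + b"
  obtain t where t: "t \<in> V" "phi t = (x, y, z)" using ch by (auto simp: hol_chart_def)
  have L: "?L s \<noteq> 0" if "s \<in> V" for s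
  proof -
    have "phi s \<in> pair_region ?P 1 3" using ch that by (auto simp: hol_chart_def)
    then show ?thesis by (simp add: pair_region_def pdP_cub)
  qed
  let ?D = "\<lambda>w. (fst w * snd w + b) * (fst w * snd w + b) - 4 * e2 * (e1 * (fst w * fst w) + a * fst w + d)"
  let ?Dx = "\<lambda>w. 2 * snd w * (fst w * snd w + b) - 4 * e2 * (2 * e1 * fst w + a)"
  have dD: "has_d2 ?D (?Dx w) (2 * fst w * (fst w * snd w + b)) w" for w
    by (rule has_d2_eq, (rule has_d2_intros)+) (simp_all add: algebra_simps)
  have D: "holo2 ?D UNIV" by (rule holo2I[OF open_UNIV]) (use dD in blast)
  have Dx: "dfst ?D = ?Dx" and Dy: "dsnd ?D = (\<lambda>w. 2 * fst w * (fst w * snd w + b))"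
    using has_d2_eqs[OF dD] by auto
  have "has_d2 (dfst ?D) (2 * snd w * snd w - 8 * e2 * e1) (2 * (fst w * snd w + b) + 2 * fst w * snd w) w" for w
    unfolding Dx by (rule has_d2_eq, (rule has_d2_intros)+) (simp_all add: algebra_simps)
  from has_d2_eqs[OF this] have Dxy: "dsnd (dfst ?D) w = 2 * (fst w * snd w + b) + 2 * fst w * snd w" for w
    by simp
  have LD: "?L s * ?L s = ?D (?X s, ?Z s)" if "s \<in> V" for s
  proof -
    have "?L s * ?L s = ?D (?X s, ?Z s) + 4 * e2 * cub 0 e1 e2 a b d (?X s, ?Y s, ?Z s)"
      by (simp add: cub_def case_prod_unfold power2_eq_square algebra_simps)
    then show ?thesis using C(4)[OF that] by simp
  qed
  have hL: "holo2 ?L V"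
    by (rule holo2I[OF holo2_open[OF C(1)]])
      (use has_d2_add[OF has_d2_add[OF has_d2_mult[OF holo2_has_d2[OF C(1)] holo2_has_d2[OF C(3)]]
          has_d2_mult[OF has_d2_const holo2_has_d2[OF C(2)]]] has_d2_const] in blast)
  have "?D (?X t, ?Z t) * dsnd (dfst ?D) (?X t, ?Z t) = dfst ?D (?X t, ?Z t) * dsnd ?D (?X t, ?Z t)"
  \<comment> \<open>The constant is -1 because Omega is dx_3 \<and> dx_1 / P_{x_2}, with the two
    differentials in the opposite order.\<close>
  proof (rule flat_hess_conn_imp[OF hc cv C(1) _ C(3) _ hL D t(1) _ L LD, of "-1"])
    show "dfst ?X s * dsnd ?Z s - dsnd ?X s * dfst ?Z s \<noteq> 0" if "s \<in> V" for s
    proof (rule jacobian_nonzero)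
      show "c1 = 0 \<and> c2 = 0" if "c1 * dfst ?X s + c2 * dsnd ?X s = 0" "c1 * dfst ?Z s + c2 * dsnd ?Z s = 0"
        "c1 * dfst ?Y s + c2 * dsnd ?Y s = 0" for c1 c2
        using C(7)[OF \<open>s \<in> V\<close>] that by blast
      show "(?Y s * ?Z s + 2 * e1 * ?X s + a) * dfst ?X s + (?X s * ?Y s - 0) * dfst ?Z s + ?L s * dfst ?Y s = 0"
        "(?Y s * ?Z s + 2 * e1 * ?X s + a) * dsnd ?X s + (?X s * ?Y s - 0) * dsnd ?Z s + ?L s * dsnd ?Y s = 0"
        using C(5,6)[OF that] by (simp_all add: algebra_simps)
    qed (rule L[OF that])
    show "Omega ?P (phi s) (dvec 1 phi s) (dvec 2 phi s) =
        - 1 * ((dfst ?X s * dsnd ?Z s - dsnd ?X s * dfst ?Z s) / ?L s)" if "s \<in> V" for s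
      by (subst Omega_13)
        (use L[OF that] C(5,6)[OF that] in \<open>simp_all add: pdP_cub dvec_eq divide_simps\<close>)
  qed simp_all
  then show ?thesis
    unfolding Dxy unfolding Dx Dy by (simp add: t(2) power2_eq_square algebra_simps)
qed

text \<open>The polynomials n and m are the values on the surface of the partial derivatives in the first and
  second variable multiplied by the one in the third.\<close>

lemma cub_web_parallel_imp:
  assumes wp: "web_locally_parallelizable (cub c e1 e2 a b d)"
    and p: "(x, y, z) \<in> web_region (cub c e1 e2 a b d)"
  defines "n \<equiv> e1 * x * x * y - 2 * c * e1 * x - a * c - e2 * y * y * y - b * y * y - d * y"
    and "m \<equiv> e2 * x * y * y - 2 * c * e2 * y - b * c - e1 * x * x * x - a * x * x - d * x"
  shows "n\<^sup>2 * (m * (2 * e2 * y) - (e2 * y * y - 3 * e1 * x * x - 2 * a * x - d) * (2 * e2 * x * y - 2 * c * e2))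
    = m\<^sup>2 * (n * (2 * e1 * x) - (2 * e1 * x * y - 2 * c * e1) * (e1 * x * x - 3 * e2 * y * y - 2 * b * y - d))"
proof -
  let ?P = "cub c e1 e2 a b d"
  obtain phi V where ch: "hol_chart (web_region ?P) phi V (x, y, z)"
    and fol: "\<forall>i\<in>{1,2,3}. \<exists>c1 c2. (c1, c2) \<noteq> (0, 0) \<and> (\<forall>y\<in>V. \<forall>v1 v2.
        d2 1 (\<lambda>z. coord i (phi z)) y * v1 + d2 2 (\<lambda>z. coord i (phi z)) y * v2 = 0 \<longleftrightarrow> c1 * v1 + c2 * v2 = 0)"
    using bspec[OF wp[unfolded web_locally_parallelizable_def] p] by blast
  have U: "web_region ?P \<subseteq> surf ?P" by (auto simp: web_region_def)
  note C = cub_chart[OF ch U]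
  let ?X = "\<lambda>z. fst (phi z)" and ?Y = "\<lambda>z. fst (snd (phi z))" and ?Z = "\<lambda>z. snd (snd (phi z))"
  have par: "\<exists>c1 c2. (c1 \<noteq> 0 \<or> c2 \<noteq> 0) \<and> (\<forall>s\<in>V. dfst F s * c2 = dsnd F s * c1)"
    if i: "i \<in> {1, 2, 3}" and F: "(\<lambda>z. coord i (phi z)) = F" for i F
  proof -
    obtain c1 c2 where c: "(c1, c2) \<noteq> (0, 0)" "\<forall>s\<in>V. \<forall>v1 v2. d2 1 F s * v1 + d2 2 F s * v2 = 0 \<longleftrightarrow> c1 * v1 + c2 * v2 = 0"
      using bspec[OF fol i] unfolding F by blast
    have "dfst F s * c2 = dsnd F s * c1" if "s \<in> V" for s
    proof -
      \<comment> \<open>(c2, - c1) spans the kernel of the constant form.\<close>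
      have "c1 * c2 + c2 * (- c1) = 0" by simp
      then have "d2 1 F s * c2 + d2 2 F s * (- c1) = 0" using c(2) that by blast
      then show ?thesis by simp
    qed
    then show ?thesis using c(1) by blast
  qed
  obtain c1 c2 where c: "c1 \<noteq> 0 \<or> c2 \<noteq> 0" "\<And>s. s \<in> V \<Longrightarrow> dfst ?X s * c2 = dsnd ?X s * c1"
    using par[of 1 ?X] by auto
  obtain k1 k2 where k: "k1 \<noteq> 0 \<or> k2 \<noteq> 0" "\<And>s. s \<in> V \<Longrightarrow> dfst ?Y s * k2 = dsnd ?Y s * k1"
    using par[of 2 ?Y] by auto
  obtain l1 l2 where l: "l1 \<noteq> 0 \<or> l2 \<noteq> 0" "\<And>s. s \<in> V \<Longrightarrow> dfst ?Z s * l2 = dsnd ?Z s * l1"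
    using par[of 3 ?Z] by auto
  obtain t where t: "t \<in> V" "phi t = (x, y, z)" using ch by (auto simp: hol_chart_def)
  define N where "N = (\<lambda>w. e1 * fst w * fst w * snd w - 2 * c * e1 * fst w - a * c - e2 * snd w * snd w * snd w - b * snd w * snd w - d * snd w)"
  define M where "M = (\<lambda>w. e2 * fst w * snd w * snd w - 2 * c * e2 * snd w - b * c - e1 * fst w * fst w * fst w - a * fst w * fst w - d * fst w)"
  let ?Nx = "\<lambda>w. 2 * e1 * fst w * snd w - 2 * c * e1" and ?Ny = "\<lambda>w. e1 * fst w * fst w - 3 * e2 * snd w * snd w - 2 * b * snd w - d"
  let ?Mx = "\<lambda>w. e2 * snd w * snd w - 3 * e1 * fst w * fst w - 2 * a * fst w - d" and ?My = "\<lambda>w. 2 * e2 * fst w * snd w - 2 * c * e2"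
  have dN: "has_d2 N (?Nx w) (?Ny w) w" for w
    unfolding N_def by (rule has_d2_eq, (rule has_d2_intros)+) (simp_all add: algebra_simps)
  have dM: "has_d2 M (?Mx w) (?My w) w" for w
    unfolding M_def by (rule has_d2_eq, (rule has_d2_intros)+) (simp_all add: algebra_simps)
  have hN: "holo2 N UNIV" by (rule holo2I[OF open_UNIV]) (use dN in blast)
  have hM: "holo2 M UNIV" by (rule holo2I[OF open_UNIV]) (use dM in blast)
  have Nx: "dfst N = ?Nx" "dsnd N = ?Ny" and Mx: "dfst M = ?Mx" "dsnd M = ?My"
    using has_d2_eqs[OF dN] has_d2_eqs[OF dM] by auto
  have "has_d2 ?Nx (2 * e1 * snd w) (2 * e1 * fst w) w" for w
    by (rule has_d2_eq, (rule has_d2_intros)+) (simp_all add: algebra_simps)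
  from has_d2_eqs(2)[OF this] have Nxy: "dsnd (dfst N) w = 2 * e1 * fst w" for w by (simp add: Nx)
  have "has_d2 ?Mx (- 6 * e1 * fst w - 2 * a) (2 * e2 * snd w) w" for w
    by (rule has_d2_eq, (rule has_d2_intros)+) (simp_all add: algebra_simps)
  from has_d2_eqs(2)[OF this] have Mxy: "dsnd (dfst M) w = 2 * e2 * snd w" for w by (simp add: Mx)
  let ?A = "\<lambda>s. ?X s * ?Y s - c"
  have wr: "?A s \<noteq> 0" "?Y s * ?Z s + 2 * e1 * ?X s + a \<noteq> 0" "?X s * ?Z s + 2 * e2 * ?Y s + b \<noteq> 0" if "s \<in> V" for s
  proof -
    have "phi s \<in> web_region ?P" using ch that by (auto simp: hol_chart_def)
    then show "?A s \<noteq> 0" "?Y s * ?Z s + 2 * e1 * ?X s + a \<noteq> 0" "?X s * ?Z s + 2 * e2 * ?Y s + b \<noteq> 0"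
      by (simp_all add: web_region_def pdP_cub)
  qed
  have N: "N (?X s, ?Y s) = ?A s * (?Y s * ?Z s + 2 * e1 * ?X s + a)"
    and M: "M (?X s, ?Y s) = ?A s * (?X s * ?Z s + 2 * e2 * ?Y s + b)" if "s \<in> V" for s
  proof -
    \<comment> \<open>Subtracting y P and x P eliminates the third variable, in which P is affine
      with coefficient \<open>?A s\<close>.\<close>
    have "N (?X s, ?Y s) = ?A s * (?Y s * ?Z s + 2 * e1 * ?X s + a) - ?Y s * cub c e1 e2 a b d (?X s, ?Y s, ?Z s)"
      "M (?X s, ?Y s) = ?A s * (?X s * ?Z s + 2 * e2 * ?Y s + b) - ?X s * cub c e1 e2 a b d (?X s, ?Y s, ?Z s)"
      by (simp_all add: N_def M_def cub_def case_prod_unfold power2_eq_square algebra_simps)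
    then show "N (?X s, ?Y s) = ?A s * (?Y s * ?Z s + 2 * e1 * ?X s + a)"
      "M (?X s, ?Y s) = ?A s * (?X s * ?Z s + 2 * e2 * ?Y s + b)"
      using C(4)[OF that] by simp_all
  qed
  have "(N (?X t, ?Y t))\<^sup>2 * (M (?X t, ?Y t) * dsnd (dfst M) (?X t, ?Y t) - dfst M (?X t, ?Y t) * dsnd M (?X t, ?Y t))
    = (M (?X t, ?Y t))\<^sup>2 * (N (?X t, ?Y t) * dsnd (dfst N) (?X t, ?Y t) - dfst N (?X t, ?Y t) * dsnd N (?X t, ?Y t))"
  proof (rule parallel_web_imp_log_slope_split[OF C(1) C(2) hN hM t(1) _ _ _ c(2) c(1) k(2) k(1) _ l(1)])
    fix s assume s: "s \<in> V"
    show "dfst ?X s * dsnd ?Y s - dsnd ?X s * dfst ?Y s \<noteq> 0"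
      by (rule jacobian_nonzero[OF C(7)[OF s] C(5)[OF s] C(6)[OF s] wr(1)[OF s]])
    show "N (?X s, ?Y s) \<noteq> 0" "M (?X s, ?Y s) \<noteq> 0" using N[OF s] M[OF s] wr[OF s] by simp_all
    \<comment> \<open>Along the surface N dx + M dy = - P_{x_3}^2 dz, so its kernel is the third
      foliation.\<close>
    have "N (?X s, ?Y s) * dfst ?X s + M (?X s, ?Y s) * dfst ?Y s = - (?A s * (?A s * dfst ?Z s))"
    proof -
      have "N (?X s, ?Y s) * dfst ?X s + M (?X s, ?Y s) * dfst ?Y s
        = ?A s * ((?Y s * ?Z s + 2 * e1 * ?X s + a) * dfst ?X s + (?X s * ?Z s + 2 * e2 * ?Y s + b) * dfst ?Y s
        + ?A s * dfst ?Z s) - ?A s * (?A s * dfst ?Z s)"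
        unfolding N[OF s] M[OF s] by (simp add: algebra_simps)
      then show ?thesis unfolding C(5)[OF s] by simp
    qed
    moreover have "N (?X s, ?Y s) * dsnd ?X s + M (?X s, ?Y s) * dsnd ?Y s = - (?A s * (?A s * dsnd ?Z s))"
    proof -
      have "N (?X s, ?Y s) * dsnd ?X s + M (?X s, ?Y s) * dsnd ?Y s
        = ?A s * ((?Y s * ?Z s + 2 * e1 * ?X s + a) * dsnd ?X s + (?X s * ?Z s + 2 * e2 * ?Y s + b) * dsnd ?Y s
        + ?A s * dsnd ?Z s) - ?A s * (?A s * dsnd ?Z s)"
        unfolding N[OF s] M[OF s] by (simp add: algebra_simps)
      then show ?thesis unfolding C(6)[OF s] by simp
    qed
    ultimately show "(N (?X s, ?Y s) * dfst ?X s + M (?X s, ?Y s) * dfst ?Y s) * l2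
      = (N (?X s, ?Y s) * dsnd ?X s + M (?X s, ?Y s) * dsnd ?Y s) * l1"
      using l(2)[OF s] by (simp add: mult.assoc)
  qed
  then show ?thesis
    unfolding Nxy Mxy unfolding Nx Mx by (simp add: t(2) N_def M_def n_def m_def)
qed

section \<open>Points of the cubics at which the necessary conditions fail\<close>

lemma exists_nonroot:
  fixes p :: "complex poly"
  assumes "p \<noteq> 0"
  obtains x where "poly p x \<noteq> 0"
  using assms by (meson poly_all_0_iff_0)

text \<open>The line y = 1 already detects the obstruction: there z is rational in x, and the
  condition becomes a polynomial identity in x. The terms of degree 9 cancel; the coefficients of
  degrees 8, 7, 6 and 5, each read off once the preceding ones have forced their parameters to
  vanish, give the alternatives of the hypothesis.\<close>

lemma cub_web_not_parallel:
  assumes nz: "c \<noteq> 0 \<or> b \<noteq> 0 \<or> (e2 \<noteq> 0 \<and> (a \<noteq> 0 \<or> d \<noteq> 0))"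
  shows "\<not> web_locally_parallelizable (cub c 1 e2 a b d)"
proof
  let ?P = "cub c 1 e2 a b d"
  assume wp: "web_locally_parallelizable ?P"
  define A N M where "A = [:- c, 1:]" and "N = [:- a * c - e2 - b - d, - 2 * c, 1:]"
    and "M = [:- 2 * c * e2 - b * c, e2 - d, - a, - 1:]"
  define W where "W = N * N * (M * [:2 * e2:] - [:e2 - d, - 2 * a, - 3:] * [:- 2 * c * e2, 2 * e2:])
      - M * M * (N * [:0, 2:] - [:- 2 * c, 2:] * [:- 3 * e2 - 2 * b - d, 0, 1:])"
  \<comment> \<open>W is the obstruction polynomial restricted to the line \<open>y = 1\<close>.\<close>
  have c8: "coeff W 8 = 2 * c"
    by (simp add: W_def N_def M_def eval_nat_numeral algebra_simps)
  have c7: "coeff W 7 = - 2 * b" if "c = 0"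
    by (simp add: W_def N_def M_def eval_nat_numeral algebra_simps that)
  have c6: "coeff W 6 = - 6 * e2 * a" if "c = 0" "b = 0"
    by (simp add: W_def N_def M_def eval_nat_numeral algebra_simps that)
  have c5: "coeff W 5 = - 16 * e2 * d" if "c = 0" "b = 0" "a = 0"
    by (simp add: W_def N_def M_def eval_nat_numeral algebra_simps that)
  have "W \<noteq> 0"
  proof
    assume W: "W = 0"
    have "c = 0" using c8 W by simp
    moreover have "b = 0" using c7[OF \<open>c = 0\<close>] W by simp
    ultimately show False using nz c6 c5 W by fastforce
  qed
  \<comment> \<open>The factors A, N and M keep the chosen point off the zero sets of P_{x_3},
    P_{x_1} and P_{x_2}; A also permits solving for z.\<close>
  moreover have "A \<noteq> 0" "N \<noteq> 0" "M \<noteq> 0" by (simp_all add: A_def N_def M_def)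
  ultimately have "A * N * M * W \<noteq> 0" by simp
  then obtain x where "poly (A * N * M * W) x \<noteq> 0" by (rule exists_nonroot)
  then have nzx: "poly A x \<noteq> 0" "poly N x \<noteq> 0" "poly M x \<noteq> 0" "poly W x \<noteq> 0" by auto
  define z where "z = - (x\<^sup>2 + e2 + a * x + b + d) / (x - c)"
  have xc: "x - c \<noteq> 0" using nzx(1) by (simp add: A_def)
  have z: "(x - c) * z = - (x\<^sup>2 + e2 + a * x + b + d)" using xc by (simp add: z_def)
  have "?P (x, 1, z) = 0" using z by (simp add: cub_def algebra_simps)
  moreover have "(x - c) * (z + 2 * x + a) = poly N x"
    using z by (simp add: N_def power2_eq_square algebra_simps)
  then have "z + 2 * x + a \<noteq> 0" using nzx(2) by auto
  moreover have "(x - c) * (x * z + 2 * e2 + b) = poly M x"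
  proof -
    have "(x - c) * (x * z + 2 * e2 + b) = x * ((x - c) * z) + (x - c) * (2 * e2 + b)" by (simp add: algebra_simps)
    then show ?thesis unfolding z by (simp add: M_def power2_eq_square algebra_simps)
  qed
  then have "x * z + 2 * e2 + b \<noteq> 0" using nzx(3) by auto
  ultimately have "(x, 1, z) \<in> web_region ?P"
    using xc by (simp add: web_region_def surf_def pdP_cub)
  from cub_web_parallel_imp[OF wp this] have "poly W x = 0"
    by (simp add: W_def N_def M_def power2_eq_square algebra_simps)
  then show False using nzx(4) by simp
qed

lemma cub_hess_not_flat_12:
  assumes "c \<noteq> 0"
  shows "\<not> hess_flat (cub c e1 e2 a b d) 1 2"
proof
  assume fl: "hess_flat (cub c e1 e2 a b d) 1 2"
  \<comment> \<open>At x = y = 0 the cubic reduces to d - c z and P_{x_3} to - c.\<close>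
  have "(0, 0, d / c) \<in> pair_region (cub c e1 e2 a b d) 1 2"
    using assms by (simp add: pair_region_def surf_def pdP_cub) (simp add: cub_def)
  from cub_hess_flat_12[OF fl this] assms show False by simp
qed

lemma cub_hess_not_flat_13:
  assumes nz: "b \<noteq> 0 \<or> (e2 \<noteq> 0 \<and> (a \<noteq> 0 \<or> d \<noteq> 0))"
  shows "\<not> hess_flat (cub 0 1 e2 a b d) 1 3"
proof
  let ?P = "cub 0 1 e2 a b d"
  assume fl: "hess_flat ?P 1 3"
  define Q where "Q = [:d, a, 1:]"
  \<comment> \<open>On the line y = 1 the surface is x z + b = - (Q + e2); substituting this into
    the condition of \<open>cub_hess_flat_13\<close> leaves K, a polynomial in x alone.\<close>
  define K where "K = [:2 * b:] * ((Q + [:e2:]) * (Q + [:e2:])) + [:8 * e2:] * (Q + [:e2:]) * [:2 * d, a:] + [:8 * b * e2:] * Q"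
  have "coeff K 4 = 2 * b" by (simp add: K_def Q_def eval_nat_numeral algebra_simps)
  moreover have "coeff K 3 = 8 * e2 * a" "coeff K 2 = 8 * e2 * (a * a + 2 * d)" if "b = 0"
    by (simp_all add: K_def Q_def eval_nat_numeral algebra_simps that)
  ultimately have "K \<noteq> 0" using nz by auto
  \<comment> \<open>On this line P_{x_2} equals e2 - Q, and x must be nonzero to solve for
    z.\<close>
  moreover have "[:e2:] - Q \<noteq> 0" "[:0, 1 :: complex:] \<noteq> 0" by (simp_all add: Q_def)
  ultimately have "[:0, 1:] * ([:e2:] - Q) * K \<noteq> 0" by (simp only: mult_eq_0_iff) simp
  then obtain x where "poly ([:0, 1:] * ([:e2:] - Q) * K) x \<noteq> 0" by (rule exists_nonroot)
  then have x: "x \<noteq> 0" "e2 - poly Q x \<noteq> 0" "poly K x \<noteq> 0" by auto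
  define z where "z = - (poly Q x + e2 + b) / x"
  have xz: "x * z = - (poly Q x + e2 + b)" using x by (simp add: z_def)
  have "?P (x, 1, z) = x * z + (poly Q x + e2 + b)"
    by (simp add: cub_def Q_def power2_eq_square algebra_simps)
  then have "(x, 1, z) \<in> pair_region ?P 1 3"
    using x xz by (simp add: pair_region_def surf_def pdP_cub)
  from cub_hess_flat_13[OF fl this] have "poly K x = 0"
    unfolding xz by (simp add: K_def Q_def power2_eq_square algebra_simps)
  then show False using x by simp
qed

text \<open>At x = 0 the condition of \<open>cub_hess_flat_13\<close> collapses to 2 b^3 = 0. This
  is the case of PI.\<close>

lemma cub_hess_not_flat_13_linear:
  assumes "b \<noteq> 0"
  shows "\<not> hess_flat (cub 0 e1 0 a b d) 1 3"
proof
  assume fl: "hess_flat (cub 0 e1 0 a b d) 1 3"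
  have "(0, - d / b, 0) \<in> pair_region (cub 0 e1 0 a b d) 1 3"
    using assms by (simp add: pair_region_def surf_def pdP_cub) (simp add: cub_def)
  from cub_hess_flat_13[OF fl this] assms show False by simp
qed

section \<open>Parallelizing coordinates\<close>

text \<open>Separation of variables: the elapsed time G is a primitive of 1 / r, injective near x0
  because its derivative is nonzero, and its inverse \<xi> is the solution curve.\<close>

lemma local_flow_box:
  fixes r :: "complex \<Rightarrow> complex"
  assumes r: "r holomorphic_on UNIV" and "open S" "x0 \<in> S" "r x0 \<noteq> 0"
  obtains U T G \<xi> where "open U" "x0 \<in> U" "U \<subseteq> S" "open T" "continuous_on U G" "G ` U = T"
    "\<forall>x\<in>U. r x \<noteq> 0" "\<forall>x\<in>U. \<xi> (G x) = x"
    "\<forall>s\<in>T. (\<xi> has_field_derivative r (\<xi> s)) (at s)"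
proof -
  have "open (S \<inter> {x. r x \<noteq> 0})"
    using holomorphic_on_imp_continuous_on[OF r] \<open>open S\<close>
    by (intro open_Int open_Collect_neq) (auto intro: continuous_on_const)
  then obtain e where e: "e > 0" "ball x0 e \<subseteq> S \<inter> {x. r x \<noteq> 0}"
    using assms(3,4) open_contains_ball by blast
  have "(\<lambda>x. 1 / r x) holomorphic_on ball x0 e"
    using e by (intro holomorphic_intros holomorphic_on_subset[OF r]) auto
  then obtain G where G0: "\<And>x. x \<in> ball x0 e \<Longrightarrow> (G has_field_derivative 1 / r x) (at x within ball x0 e)"
    using holomorphic_convex_primitive'[of "ball x0 e"] by auto
  have G: "(G has_field_derivative 1 / r x) (at x)" if "x \<in> ball x0 e" for x
    using G0[OF that] unfolding at_within_open[OF that open_ball] .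
  have Gh: "G holomorphic_on ball x0 e"
    unfolding holomorphic_on_open[OF open_ball] using G by blast
  have "deriv G x0 \<noteq> 0"
    using G[of x0] e assms(4) by (simp add: DERIV_imp_deriv)
  then obtain \<delta> where \<delta>: "\<delta> > 0" "ball x0 \<delta> \<subseteq> ball x0 e" "inj_on G (ball x0 \<delta>)"
    using has_complex_derivative_locally_injective[OF Gh, of x0] e by auto
  have Gh': "G holomorphic_on ball x0 \<delta>" using Gh \<delta>(2) by (rule holomorphic_on_subset)
  have oT: "open (G ` ball x0 \<delta>)" by (rule open_mapping_thm3[OF Gh' open_ball \<delta>(3)])
  obtain \<xi> where \<xi>: "\<xi> holomorphic_on G ` ball x0 \<delta>"
      "\<And>z. z \<in> ball x0 \<delta> \<Longrightarrow> deriv G z * deriv \<xi> (G z) = 1" "\<And>z. z \<in> ball x0 \<delta> \<Longrightarrow> \<xi> (G z) = z"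
    using holomorphic_has_inverse[OF Gh' open_ball \<delta>(3)] by metis
  have nz: "r x \<noteq> 0" if "x \<in> ball x0 \<delta>" for x using \<delta>(2) e(2) that by blast
  have "(\<xi> has_field_derivative r (\<xi> s)) (at s)" if s: "s \<in> G ` ball x0 \<delta>" for s
  proof -
    obtain x where x: "x \<in> ball x0 \<delta>" "s = G x" using s by blast
    have dG: "deriv G x = 1 / r x" using G[of x] x \<delta>(2) by (blast intro: DERIV_imp_deriv)
    have "deriv \<xi> s = r (\<xi> s)"
      using \<xi>(2,3)[OF x(1)] nz[OF x(1)] unfolding dG x(2) by (simp add: field_simps)
    then show ?thesis
      using holomorphic_derivI[OF \<xi>(1) oT s] by simp
  qed
  then show thesis
    using \<delta> e nz \<xi>(3) oT holomorphic_on_imp_continuous_on[OF Gh']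
    by (intro that[of "ball x0 \<delta>" "G ` ball x0 \<delta>" G \<xi>]) auto
qed

text \<open>Without the squares the variables separate: the third foliation is the kernel of
  \<open>dx / r(x) + dy / q(y)\<close>, so the times of the flows of r and q are parallelizing coordinates.\<close>

lemma cub_web_parallel:
  "web_locally_parallelizable (cub c 0 0 a b d)"
  unfolding web_locally_parallelizable_def
proof
  let ?P = "cub c 0 0 a b d"
  define r where "r x = - a * x * x - d * x - b * c" for x
  define q where "q y = - b * y * y - d * y - a * c" for y
  fix p assume p: "p \<in> web_region ?P"
  obtain x0 y0 z0 where p0: "p = (x0, y0, z0)" by (cases p)
  have z0: "(x0 * y0 - c) * z0 = - (a * x0 + b * y0 + d)" and A0: "x0 * y0 - c \<noteq> 0"
    and nz: "y0 * z0 + a \<noteq> 0" "x0 * z0 + b \<noteq> 0"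
  proof -
    have "?P (x0, y0, z0) = 0" using p by (simp add: p0 web_region_def surf_def)
    moreover have "?P (x0, y0, z0) = (x0 * y0 - c) * z0 - (- (a * x0 + b * y0 + d))"
      by (simp add: cub_def algebra_simps)
    ultimately show "(x0 * y0 - c) * z0 = - (a * x0 + b * y0 + d)" by simp
  qed (use p in \<open>simp_all add: p0 web_region_def pdP_cub\<close>)
  \<comment> \<open>This is the origin of r and q: without squares, the product of P_{x_3} with
    either of the other partial derivatives depends, on the surface, on a single variable.\<close>
  have PxPz: "(x * y - c) * (y * z + a) = q y" "(x * y - c) * (x * z + b) = r x"
    if "(x * y - c) * z = - (a * x + b * y + d)" for x y z
  proof -
    have "(x * y - c) * (y * z + a) = y * ((x * y - c) * z) + a * (x * y - c)"
      "(x * y - c) * (x * z + b) = x * ((x * y - c) * z) + b * (x * y - c)"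
      by (simp_all add: algebra_simps)
    then show "(x * y - c) * (y * z + a) = q y" "(x * y - c) * (x * z + b) = r x"
      unfolding that by (simp_all add: r_def q_def algebra_simps)
  qed
  have r0: "r x0 \<noteq> 0" "q y0 \<noteq> 0"
    using PxPz[OF z0] A0 nz by (metis mult_eq_0_iff)+
  \<comment> \<open>The two times vary independently, so x y \<noteq> c is needed on a whole box
    around (x0, y0).\<close>
  have "open {w :: pt2. fst w * snd w - c \<noteq> 0}"
    by (intro open_Collect_neq continuous_intros)
  then obtain S1 S2 where S: "open S1" "open S2" "(x0, y0) \<in> S1 \<times> S2" "S1 \<times> S2 \<subseteq> {w. fst w * snd w - c \<noteq> 0}"
    using A0 open_prod_elim[of "{w :: pt2. fst w * snd w - c \<noteq> 0}" "(x0, y0)"] by auto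
  have hr: "r holomorphic_on UNIV" "q holomorphic_on UNIV" unfolding r_def q_def by (intro holomorphic_intros)+
  have xS: "x0 \<in> S1" "y0 \<in> S2" using S(3) by auto
  obtain U1 T1 G1 \<xi> where f1': "open U1" "x0 \<in> U1" "U1 \<subseteq> S1" "open T1" "continuous_on U1 G1" "G1 ` U1 = T1"
    "\<forall>x\<in>U1. r x \<noteq> 0" "\<forall>x\<in>U1. \<xi> (G1 x) = x"
    "\<forall>s\<in>T1. (\<xi> has_field_derivative r (\<xi> s)) (at s)"
    by (rule local_flow_box[OF hr(1) S(1) xS(1) r0(1)])
  note f1 = f1'[rule_format]
  obtain U2 T2 G2 \<eta> where f2': "open U2" "y0 \<in> U2" "U2 \<subseteq> S2" "open T2" "continuous_on U2 G2" "G2 ` U2 = T2"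
    "\<forall>x\<in>U2. q x \<noteq> 0" "\<forall>x\<in>U2. \<eta> (G2 x) = x"
    "\<forall>s\<in>T2. (\<eta> has_field_derivative q (\<eta> s)) (at s)"
    by (rule local_flow_box[OF hr(2) S(2) xS(2) r0(2)])
  note f2 = f2'[rule_format]
  have A: "x * y - c \<noteq> 0" if "x \<in> U1" "y \<in> U2" for x y
    using subsetD[OF S(4), of "(x, y)"] f1(3) f2(3) that by auto
  have \<xi>U: "\<xi> s \<in> U1" "G1 (\<xi> s) = s" if "s \<in> T1" for s using that f1(6,8) by auto
  have \<eta>U: "\<eta> s \<in> U2" "G2 (\<eta> s) = s" if "s \<in> T2" for s using that f2(6,8) by auto
  define h where "h x y = (- a * x - b * y - d) / (x * y - c)" for x y
  define phi where "phi w = (\<xi> (fst w), \<eta> (snd w), h (\<xi> (fst w)) (\<eta> (snd w)))" for w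
  define V where "V = T1 \<times> T2"
  have oV: "open V" using f1 f2 by (simp add: V_def open_Times)
  have d1: "has_d2 (\<lambda>w. \<xi> (fst w)) (r (\<xi> (fst w))) 0 w" if "w \<in> V" for w
    using has_d2_DERIV[of \<xi> _ fst w, OF f1(9) has_d2_fst] that by (auto simp: V_def)
  have d2': "has_d2 (\<lambda>w. \<eta> (snd w)) 0 (q (\<eta> (snd w))) w" if "w \<in> V" for w
    using has_d2_DERIV[of \<eta> _ snd w, OF f2(9) has_d2_snd] that by (auto simp: V_def)
  \<comment> \<open>Common value of both time derivatives of z. As they agree, the third foliation
    is the kernel of the sum of the two time differentials.\<close>
  define k where "k w = - (r (\<xi> (fst w)) * q (\<eta> (snd w))) / (\<xi> (fst w) * \<eta> (snd w) - c)\<^sup>2" for w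
  have inU: "\<xi> (fst w) \<in> U1" "\<eta> (snd w) \<in> U2" if "w \<in> V" for w
    using that \<xi>U \<eta>U by (auto simp: V_def)
  have d3: "has_d2 (\<lambda>w. h (\<xi> (fst w)) (\<eta> (snd w))) (k w) (k w) w" if w: "w \<in> V" for w
  proof -
    let ?x = "\<xi> (fst w)" and ?y = "\<eta> (snd w)"
    have nz: "?x * ?y - c \<noteq> 0" using A inU[OF w] by blast
    have num: "has_d2 (\<lambda>w. - a * \<xi> (fst w) - b * \<eta> (snd w) - d) (- a * r ?x) (- b * q ?y) w"
      by (rule has_d2_eq, (rule has_d2_intros d1[OF w] d2'[OF w])+) simp_all
    have den: "has_d2 (\<lambda>w. \<xi> (fst w) * \<eta> (snd w) - c) (r ?x * ?y) (?x * q ?y) w"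
      by (rule has_d2_eq, (rule has_d2_intros d1[OF w] d2'[OF w])+) simp_all
    have "- a * r ?x * (?x * ?y - c) - (- a * ?x - b * ?y - d) * (r ?x * ?y) = - (r ?x * q ?y)"
      "- b * q ?y * (?x * ?y - c) - (- a * ?x - b * ?y - d) * (?x * q ?y) = - (r ?x * q ?y)"
      by (simp_all add: q_def r_def algebra_simps)
    then show ?thesis
      unfolding h_def using has_d2_divide[OF num den nz] by (simp only: k_def)
  qed
  have "hol_chart (web_region ?P) phi V p"
    unfolding hol_chart_def
  proof (intro conjI)
    show "open V" by fact
    show "\<forall>i\<in>{1, 2, 3}. holo2 (\<lambda>y. coord i (phi y)) V"
      using d1 d2' d3 by (auto simp: phi_def intro!: holo2I[OF oV]; blast)
    \<comment> \<open>Over the box the web region is the full graph of h: P_{x_1} and P_{x_2} cannot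
      vanish there because q and r do not.\<close>
    have sub: "(x, y, z) \<in> web_region ?P \<longleftrightarrow> z = h x y" if "x \<in> U1" "y \<in> U2" for x y z
    proof
      assume "(x, y, z) \<in> web_region ?P"
      then have "?P (x, y, z) = 0" by (simp add: web_region_def surf_def)
      then show "z = h x y" using A[OF that] by (simp add: h_def cub_def field_simps)
    next
      assume z: "z = h x y"
      then have "(x * y - c) * z = - a * x - b * y - d" using A[OF that] by (simp add: h_def)
      also have "\<dots> = - (a * x + b * y + d)" by simp
      finally have z': "(x * y - c) * z = - (a * x + b * y + d)" .
      have "?P (x, y, z) = (x * y - c) * z - (- (a * x + b * y + d))" by (simp add: cub_def algebra_simps)
      then have "?P (x, y, z) = 0" unfolding z' by simp
      moreover have "y * z + a \<noteq> 0" "x * z + b \<noteq> 0"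
        using PxPz[OF z'] f1(7)[OF that(1)] f2(7)[OF that(2)] by (metis mult_zero_right)+
      ultimately show "(x, y, z) \<in> web_region ?P"
        using A[OF that] by (simp add: web_region_def surf_def pdP_cub)
    qed
    have im: "phi ` V = web_region ?P \<inter> {w. fst w \<in> U1 \<and> fst (snd w) \<in> U2}"
    proof (intro equalityI subsetI)
      fix w assume "w \<in> phi ` V"
      then obtain v where v: "v \<in> V" "w = phi v" by blast
      then show "w \<in> web_region ?P \<inter> {w. fst w \<in> U1 \<and> fst (snd w) \<in> U2}"
        using inU[OF v(1)] sub by (simp add: phi_def)
    next
      fix w assume w: "w \<in> web_region ?P \<inter> {w. fst w \<in> U1 \<and> fst (snd w) \<in> U2}"
      obtain x y z where xyz: "w = (x, y, z)" by (cases w)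
      have U: "x \<in> U1" "y \<in> U2" using w xyz by auto
      have "z = h x y" using w sub[OF U] xyz by simp
      then have "w = phi (G1 x, G2 y)" using U f1(8) f2(8) by (simp add: phi_def xyz)
      moreover have "(G1 x, G2 y) \<in> V" using U f1(6) f2(6) by (auto simp: V_def)
      ultimately show "w \<in> phi ` V" by blast
    qed
    then show "phi ` V \<subseteq> web_region ?P" by blast
    show "p \<in> phi ` V" using p p0 im f1(2) f2(2) by simp
    have "open {w :: pt3. fst w \<in> U1 \<and> fst (snd w) \<in> U2}"
    proof -
      have "{w :: pt3. fst w \<in> U1 \<and> fst (snd w) \<in> U2} = U1 \<times> U2 \<times> UNIV" by auto
      then show ?thesis using f1(1) f2(1) by (simp add: open_Times)
    qed
    then show "openin (top_of_set (web_region ?P)) (phi ` V)"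
      unfolding im by (rule openin_open_Int)
    have inv: "(G1 (fst (phi v)), G2 (fst (snd (phi v)))) = v" if "v \<in> V" for v
      using that \<xi>U(2) \<eta>U(2) by (auto simp: phi_def V_def)
    then show inj: "inj_on phi V" by (metis inj_onI)
    have "continuous_on (phi ` V) (\<lambda>w. (G1 (fst w), G2 (fst (snd w))))"
      unfolding im
      by (intro continuous_on_Pair continuous_on_compose2[OF f1(5)] continuous_on_compose2[OF f2(5)] continuous_intros) auto
    then show "continuous_on (phi ` V) (the_inv_into V phi)"
      by (rule continuous_on_eq) (use inv the_inv_into_f_f[OF inj] in auto)
    show "\<forall>y\<in>V. \<forall>c1 c2. (\<forall>i\<in>{1, 2, 3}. c1 * coord i (dvec 1 phi y) + c2 * coord i (dvec 2 phi y) = 0)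
        \<longrightarrow> c1 = 0 \<and> c2 = 0"
    proof (intro ballI allI impI)
      fix w c1 c2 assume w: "w \<in> V"
        and "\<forall>i\<in>{1, 2, 3}. c1 * coord i (dvec 1 phi w) + c2 * coord i (dvec 2 phi w) = 0"
      then have "c1 * r (\<xi> (fst w)) = 0" "c2 * q (\<eta> (snd w)) = 0"
        using has_d2_eqs[OF d1[OF w]] has_d2_eqs[OF d2'[OF w]] by (simp_all add: dvec_eq phi_def)
      then show "c1 = 0 \<and> c2 = 0" using f1(7) f2(7) inU[OF w] by (metis mult_eq_0_iff)
    qed
  qed
  moreover have "\<forall>i\<in>{1, 2, 3}. \<exists>c1 c2. (c1, c2) \<noteq> (0, 0) \<and> (\<forall>y\<in>V. \<forall>v1 v2.
      d2 1 (\<lambda>z. coord i (phi z)) y * v1 + d2 2 (\<lambda>z. coord i (phi z)) y * v2 = 0 \<longleftrightarrow> c1 * v1 + c2 * v2 = 0)"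
  proof
    fix i :: nat assume i: "i \<in> {1, 2, 3}"
    \<comment> \<open>With s and t the two times, the constant forms for i = 1, 2, 3 are ds, dt and
      ds + dt.\<close>
    define c1 c2 :: complex where "c1 = (if i = 2 then 0 else 1)" and "c2 = (if i = 1 then 0 else 1)"
    have "d2 1 (\<lambda>z. coord i (phi z)) w * v1 + d2 2 (\<lambda>z. coord i (phi z)) w * v2 = 0 \<longleftrightarrow> c1 * v1 + c2 * v2 = 0"
      if w: "w \<in> V" for w v1 v2
    proof -
      have nz: "r (\<xi> (fst w)) \<noteq> 0" "q (\<eta> (snd w)) \<noteq> 0" "\<xi> (fst w) * \<eta> (snd w) - c \<noteq> 0"
        using f1(7) f2(7) A inU[OF w] by blast+
      then have "k w \<noteq> 0" by (simp add: k_def)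
      moreover have "k w * v1 + k w * v2 = k w * (v1 + v2)" by (simp add: algebra_simps)
      ultimately show ?thesis
        using i nz has_d2_eqs[OF d1[OF w]] has_d2_eqs[OF d2'[OF w]] has_d2_eqs[OF d3[OF w]]
        by (auto simp: phi_def c1_def c2_def)
    qed
    moreover have "(c1, c2) \<noteq> (0, 0)" by (simp add: c1_def c2_def)
    ultimately show "\<exists>c1 c2. (c1, c2) \<noteq> (0, 0) \<and> (\<forall>y\<in>V. \<forall>v1 v2.
      d2 1 (\<lambda>z. coord i (phi z)) y * v1 + d2 2 (\<lambda>z. coord i (phi z)) y * v2 = 0 \<longleftrightarrow> c1 * v1 + c2 * v2 = 0)"
      by blast
  qed
  ultimately show "\<exists>phi V. hol_chart (web_region ?P) phi V p \<and> (\<forall>i\<in>{1,2,3}. \<exists>c1 c2. (c1, c2) \<noteq> (0, 0) \<and>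
      (\<forall>y\<in>V. \<forall>v1 v2. d2 1 (\<lambda>z. coord i (phi z)) y * v1 + d2 2 (\<lambda>z. coord i (phi z)) y * v2 = 0
        \<longleftrightarrow> c1 * v1 + c2 * v2 = 0))"
    by blast
qed

section \<open>The list of cubics\<close>

text \<open>The disjunction is what keeps the obstruction polynomials nonzero. PV and PIV have
  \<open>c \<noteq> 0\<close> and PIII(D7) has \<open>b = 1\<close>; in the other families b can
  vanish, but e2 is 1 or -1 and d (PV^deg, PIII(D6)) or a (PIII(D8)) is nonzero.\<close>

lemma nonexc_cubics_cub:
  assumes "P \<in> nonexc_cubics"
  obtains c e2 a b d where "P = cub c 1 e2 a b d" "c \<noteq> 0 \<or> b \<noteq> 0 \<or> (e2 \<noteq> 0 \<and> (a \<noteq> 0 \<or> d \<noteq> 0))"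
proof -
  have eqs:
    "(\<lambda>(x1,x2,x3). x1 * x2 * x3 + x1^2 + x2^2 - (s1 + s2 * s3)*x1 - (s2 + s1 * s3)*x2 - s3 * x3 + (s3^2 + s1 * s2 * s3 + 1))
      = cub s3 1 1 (- (s1 + s2 * s3)) (- (s2 + s1 * s3)) (s3\<^sup>2 + s1 * s2 * s3 + 1)"
    "(\<lambda>(x1,x2,x3). x1 * x2 * x3 + x1^2 + x2^2 + s1 * x1 + s2 * x2 + 1) = cub 0 1 1 s1 s2 1"
    "(\<lambda>(x1,x2,x3). x1 * x2 * x3 + x1^2 + x2^2 + (1 + \<alpha>*\<beta>)*x1 + (\<alpha> + \<beta>)*x2 + \<alpha>*\<beta>)
      = cub 0 1 1 (1 + \<alpha> * \<beta>) (\<alpha> + \<beta>) (\<alpha> * \<beta>)"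
    "(\<lambda>(x1,x2,x3). x1 * x2 * x3 + x1^2 + x2^2 + \<alpha>*x1 + x2) = cub 0 1 1 \<alpha> 1 0"
    "(\<lambda>(x1,x2,x3). x1 * x2 * x3 + x1^2 - x2^2 - x1) = cub 0 1 (- 1) (- 1) 0 0"
    "(\<lambda>(x1,x2,x3). x1 * x2 * x3 + x1^2 - (s2^2 + s1 * s2)*x1 - s2^2 * x2 - s2^2 * x3 + (s2^2 + s1 * s2^3))
      = cub (s2\<^sup>2) 1 0 (- (s2\<^sup>2 + s1 * s2)) (- s2\<^sup>2) (s2\<^sup>2 + s1 * s2 ^ 3)"
    for s1 s2 s3 \<alpha> \<beta> :: complex
    by (auto simp: cub_def fun_eq_iff algebra_simps)
  consider
    (PV) s1 s2 s3 where "s3 \<noteq> 0" "P = cub s3 1 1 (- (s1 + s2 * s3)) (- (s2 + s1 * s3)) (s3\<^sup>2 + s1 * s2 * s3 + 1)"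
  | (PVdeg) s1 s2 where "P = cub 0 1 1 s1 s2 1"
  | (D6) \<alpha> \<beta> where "\<alpha> \<noteq> 0" "\<beta> \<noteq> 0" "P = cub 0 1 1 (1 + \<alpha> * \<beta>) (\<alpha> + \<beta>) (\<alpha> * \<beta>)"
  | (D7) \<alpha> where "P = cub 0 1 1 \<alpha> 1 0"
  | (D8) "P = cub 0 1 (- 1) (- 1) 0 0"
  | (PIV) s1 s2 where "s2 \<noteq> 0" "P = cub (s2\<^sup>2) 1 0 (- (s2\<^sup>2 + s1 * s2)) (- s2\<^sup>2) (s2\<^sup>2 + s1 * s2 ^ 3)"
    using assms unfolding nonexc_cubics_def eqs by blast
  then show thesis by cases (rule that, assumption, simp)+
qed

text \<open>The disjunction serves non-flatness: c is -1 or 1 for PII^FN and PII, which leads to the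
  pair (1,2), while PI has \<open>c = 0\<close> and \<open>b = 1\<close>, which leads to the pair
  (1,3).\<close>

lemma exc_cubics_cub:
  assumes "P \<in> exc_cubics"
  obtains c a b d where "P = cub c 0 0 a b d" "c \<noteq> 0 \<or> b \<noteq> 0"
proof -
  have eqs:
    "(\<lambda>(x1,x2,x3). x1 * x2 * x3 + x1 - x2 + x3 + s) = cub (- 1) 0 0 1 (- 1) s"
    "(\<lambda>(x1,x2,x3). x1 * x2 * x3 - x1 - \<alpha>*x2 - x3 + \<alpha> + 1) = cub 1 0 0 (- 1) (- \<alpha>) (\<alpha> + 1)"
    "(\<lambda>(x1,x2,x3). x1 * x2 * x3 + x1 + x2 + 1) = cub 0 0 0 1 1 1" for s \<alpha> :: complex
    by (auto simp: cub_def fun_eq_iff algebra_simps)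
  consider (FN) s where "P = cub (- 1) 0 0 1 (- 1) s" | (PII) \<alpha> where "P = cub 1 0 0 (- 1) (- \<alpha>) (\<alpha> + 1)"
    | (PI) "P = cub 0 0 0 1 1 1"
    using assms unfolding exc_cubics_def eqs by blast
  then show thesis by cases (rule that, assumption, simp)+
qed

theorem theorem1p3:
  fixes P :: "complex \<times> complex \<times> complex \<Rightarrow> complex"
  assumes "P \<in> nonexc_cubics \<union> exc_cubics"
  shows "(P \<in> nonexc_cubics \<longrightarrow> \<not> web_locally_parallelizable P) \<and>
         (P \<in> exc_cubics \<longrightarrow> web_locally_parallelizable P) \<and>
         (\<exists>i\<in>{1,2,3::nat}. \<exists>j\<in>{1,2,3::nat}. i \<noteq> j \<and> \<not> hess_flat P i j)"
proof (intro conjI impI)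
  show "\<not> web_locally_parallelizable P" if "P \<in> nonexc_cubics"
    using nonexc_cubics_cub[OF that] cub_web_not_parallel by metis
  show "web_locally_parallelizable P" if "P \<in> exc_cubics"
    using exc_cubics_cub[OF that] cub_web_parallel by metis
  have "\<not> hess_flat P 1 2 \<or> \<not> hess_flat P 1 3"
  proof (cases "P \<in> exc_cubics")
    case True
    then obtain c a b d where "P = cub c 0 0 a b d" "c \<noteq> 0 \<or> b \<noteq> 0" by (rule exc_cubics_cub)
    then show ?thesis using cub_hess_not_flat_12 cub_hess_not_flat_13_linear by (cases "c = 0") blast+
  next
    case False
    then have "P \<in> nonexc_cubics" using assms by blast
    then obtain c e2 a b d where "P = cub c 1 e2 a b d" "c \<noteq> 0 \<or> b \<noteq> 0 \<or> (e2 \<noteq> 0 \<and> (a \<noteq> 0 \<or> d \<noteq> 0))"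
      by (rule nonexc_cubics_cub)
    then show ?thesis using cub_hess_not_flat_12 cub_hess_not_flat_13 by (cases "c = 0") blast+
  qed
  then show "\<exists>i\<in>{1,2,3::nat}. \<exists>j\<in>{1,2,3::nat}. i \<noteq> j \<and> \<not> hess_flat P i j"
    by auto
qed

end
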